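(* Let $b\ge 2$ and $d\ge b$ be integers and let $\eta=\eta_{b,p}$ be the Bernoulli convolution in base $b$ associated with the uniform probability vector $p_0=\dots=p_{d-1}=\frac1d$. For $\alpha\in\mathbb R$ let $$E(\alpha):=\Big\{x\in\mathbb R : \lim_{r\to0}\frac{\log\eta\big((x-r,x+r)\big)}{\log r}=\alpha\Big\}.$$ Then, with $\mathcal E(\cdot)$ denoting the level sets of the function $\mathcal N$ (the number of representations in base $b$ with digits in $\{0,\dots,d-1\}$), $$\mathrm{H\text{-}dim}(E(\alpha))\le \mathrm d_-^{\exp}\Big(\mathcal E\Big(\frac{\log d}{\log b}-\alpha\Big)\Big).$$
   Context: $\mathbb N=\{1,2,\dots\}$ and $\mathrm{H\text{-}dim}$ is Hausdorff dimension. The Bernoulli convolution is the probability measure on $\mathbb R$ defined by $\eta_{b,p}(I)=P_p\big(\{(\omega_k)_{k\in\mathbb N}: 0\le\omega_k\le d-1,\ \sum_{k\ge1}\omega_k b^{-k}\in I\}\big)$ for every interval $I$, where $P_p$ is the product probability on $\{0,\dots,d-1\}^{\mathbb N}$ determined by $p$. For $n\in\mathbb N$, $\mathcal N(n):=\#\{(\omega_i)_{i\ge0}: n=\sum_{i\ge0}\omega_i b^i,\ \omega_i\in\{0,\dots,d-1\}\}$. For $S\subset\mathbb N$, the lower exponential density is $\mathrm d_-^{\exp}(S)=\liminf_{N\to\infty}\frac{\log(\#(S\cap[1,N)))}{\log N}$, with the convention that $\log(\#(S\cap[1,N)))$ is replaced by $0$ when $S\cap[1,N)$ is empty. For $f:\mathbb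 N\to(0,\infty)$, $\gamma\in\mathbb R$ and $\varepsilon>0$, put $\mathcal E(\gamma,\varepsilon)=\{n\ge2: \gamma-\varepsilon\le\frac{\log f(n)}{\log n}\le\gamma+\varepsilon\}$. The level set $\mathcal E(\gamma)$ of $f$ is a set of the form $\bigcup_{k\ge1}(\mathcal E(\gamma,1/k)\cap[N_k,N_{k+1}))$ with integers $1=N_1<N_2<\cdots$ chosen so that its densities are the limits of those of $\mathcal E(\gamma,\varepsilon)$ as $\varepsilon\to0$. In particular, independently of the choice, $\mathrm d_-^{\exp}(\mathcal E(\gamma))=\lim_{\varepsilon\to0}\mathrm d_-^{\exp}(\mathcal E(\gamma,\varepsilon))=\inf_{\varepsilon>0}\mathrm d_-^{\exp}(\mathcal E(\gamma,\varepsilon))$; this value is what $\mathrm d_-^{\exp}(\mathcal E(\gamma))$ denotes. Here it is applied with $f=\mathcal N$. *)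

theory Defs
  imports "HOL-Probability.Probability"
begin

section \<open>Hausdorff dimension\<close>

text \<open>
  The diameter gauge \<open>|U|^s\<close>, with \<open>|{}|^s = 0\<close> and \<open>|U|^0 = 1\<close> for nonempty \<open>U\<close>
  (note that \<open>0 powr 0 = 0\<close>, which would be wrong for singletons at \<open>s = 0\<close>).
\<close>

definition diam_gauge :: "real \<Rightarrow> 'a::metric_space set \<Rightarrow> ennreal" where
  "diam_gauge s U =
     (if U = {} then 0 else if s = 0 then 1 else ennreal (diameter U powr s))"

text \<open>
  The condition \<open>bounded\<close> is needed because \<open>diameter\<close> is a junk value on unbounded sets.
\<close>

definition hausdorff_covers :: "real \<Rightarrow> 'a::metric_space set \<Rightarrow> (nat \<Rightarrow> 'a set) set" where
  "hausdorff_covers \<delta> A =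
     {U. A \<subseteq> (\<Union>i. U i) \<and> (\<forall>i. bounded (U i) \<and> diameter (U i) \<le> \<delta>)}"

definition hausdorff_measure :: "real \<Rightarrow> 'a::metric_space set \<Rightarrow> ennreal" where
  "hausdorff_measure s A =
     (SUP \<delta>\<in>{0<..}. INF U\<in>hausdorff_covers \<delta> A. \<Sum>i. diam_gauge s (U i))"

text \<open>With this definition the empty set has dimension \<open>0\<close>.\<close>

definition hausdorff_dim :: "'a::metric_space set \<Rightarrow> ereal" where
  "hausdorff_dim A = (INF s\<in>{s. 0 \<le> s \<and> hausdorff_measure s A = 0}. ereal s)"

section \<open>Bernoulli convolutions\<close>

text \<open>The digit \<open>\<omega>\<^sub>k\<close>, \<open>k \<ge> 1\<close>, of the expansion is stored at index \<open>k - 1\<close>.\<close>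

definition digit_measure :: "nat \<Rightarrow> (nat \<Rightarrow> real) \<Rightarrow> (nat \<Rightarrow> nat) measure" where
  "digit_measure d p = (\<Pi>\<^sub>M k\<in>UNIV. point_measure {..<d} (\<lambda>i. ennreal (p i)))"

definition base_expansion :: "nat \<Rightarrow> (nat \<Rightarrow> nat) \<Rightarrow> real" where
  "base_expansion b \<omega> = (\<Sum>k. real (\<omega> k) / real b ^ Suc k)"

definition bernoulli_convolution :: "nat \<Rightarrow> nat \<Rightarrow> (nat \<Rightarrow> real) \<Rightarrow> real measure" where
  "bernoulli_convolution b d p = distr (digit_measure d p) borel (base_expansion b)"

lemma base_expansion_measurable: "base_expansion b \<in> borel_measurable (digit_measure d p)"
proof -
  have "(\<lambda>\<omega>. real (\<omega> k) / real b ^ Suc k) \<in> borel_measurable (digit_measure d p)" for k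
  proof -
    have 1: "(\<lambda>\<omega>. \<omega> k) \<in> digit_measure d p \<rightarrow>\<^sub>M point_measure {..<d} (\<lambda>i. ennreal (p i))"
      unfolding digit_measure_def by (rule measurable_component_singleton) simp
    have 2: "(\<lambda>i. real i / real b ^ Suc k)
        \<in> borel_measurable (point_measure {..<d} (\<lambda>i. ennreal (p i)))"
      by simp
    show ?thesis
      using measurable_compose[OF 1 2] by simp
  qed
  then show ?thesis
    unfolding base_expansion_def[abs_def] by (rule borel_measurable_suminf)
qed

lemma prob_space_bernoulli_convolution:
  assumes "\<And>i. i < d \<Longrightarrow> 0 \<le> p i" "(\<Sum>i<d. p i) = 1"
  shows "prob_space (bernoulli_convolution b d p)"
proof -
  have "(\<Sum>i<d. ennreal (p i)) = 1"
    using assms by (subst sum_ennreal) auto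
  then have "prob_space (point_measure {..<d} (\<lambda>i. ennreal (p i)))"
    by (intro prob_spaceI) (simp add: space_point_measure emeasure_point_measure_finite)
  then have "prob_space (digit_measure d p)"
    unfolding digit_measure_def by (intro prob_space_PiM)
  then show ?thesis
    unfolding bernoulli_convolution_def
    by (rule prob_space.prob_space_distr[OF _ base_expansion_measurable])
qed

text \<open>
  Since \<open>ln 0 = 0\<close> in the library, a point outside the support of \<open>\<mu>\<close> would otherwise get local
  dimension \<open>0\<close>. The positivity condition says that the logarithm in the quotient is meaningful.
\<close>

definition local_dim_level_set :: "real measure \<Rightarrow> real \<Rightarrow> real set" where
  "local_dim_level_set \<mu> \<alpha> =
     {x. (\<forall>r>0. measure \<mu> {x - r<..<x + r} > 0) \<and>
         ((\<lambda>r. ln (measure \<mu> {x - r<..<x + r}) / ln r) \<longlongrightarrow> \<alpha>) (at_right 0)}"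

section \<open>Representations in base \<open>b\<close> with digits in \<open>{0,\<dots>,d-1}\<close>\<close>

text \<open>
  For \<open>n = \<Sum> \<omega>\<^sub>i b^i\<close> to hold, almost all digits must vanish, so the infinite sum is
  the finite sum over the support of \<open>\<omega>\<close>.
\<close>

definition representations :: "nat \<Rightarrow> nat \<Rightarrow> nat \<Rightarrow> (nat \<Rightarrow> nat) set" where
  "representations b d n =
     {\<omega>. (\<forall>i. \<omega> i < d) \<and> finite {i. \<omega> i \<noteq> 0} \<and> n = (\<Sum>i | \<omega> i \<noteq> 0. \<omega> i * b ^ i)}"

definition num_representations :: "nat \<Rightarrow> nat \<Rightarrow> nat \<Rightarrow> nat" where
  "num_representations b d n = card (representations b d n)"

lemma finite_representations:
  assumes "2 \<le> b"
  shows "finite (representations b d n)"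
proof (rule finite_subset)
  show "representations b d n \<subseteq> {\<omega>. \<forall>i. (i \<in> {..n} \<longrightarrow> \<omega> i \<in> {..<d}) \<and> (i \<notin> {..n} \<longrightarrow> \<omega> i = 0)}"
  proof
    fix \<omega> assume \<omega>: "\<omega> \<in> representations b d n"
    have "\<omega> i = 0" if "i > n" for i
    proof (rule ccontr)
      assume "\<omega> i \<noteq> 0"
      have "i < 2 ^ i" by (rule less_exp)
      also have "\<dots> \<le> b ^ i" using assms by (rule power_mono) simp
      also have "\<dots> \<le> \<omega> i * b ^ i" using \<open>\<omega> i \<noteq> 0\<close> by simp
      also have "\<dots> \<le> (\<Sum>i | \<omega> i \<noteq> 0. \<omega> i * b ^ i)"
        using \<omega> \<open>\<omega> i \<noteq> 0\<close> by (intro member_le_sum) (auto simp: representations_def)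
      also have "\<dots> = n" using \<omega> by (simp add: representations_def)
      finally show False using that by simp
    qed
    moreover have "\<omega> i < d" for i
      using \<omega> unfolding representations_def by blast
    ultimately show "\<omega> \<in> {\<omega>. \<forall>i. (i \<in> {..n} \<longrightarrow> \<omega> i \<in> {..<d}) \<and> (i \<notin> {..n} \<longrightarrow> \<omega> i = 0)}"
      by simp
  qed
  show "finite {\<omega>. \<forall>i. (i \<in> {..n} \<longrightarrow> \<omega> i \<in> {..<d}) \<and> (i \<notin> {..n} \<longrightarrow> \<omega> i = (0::nat))}"
    by (rule finite_set_of_finite_funs) auto
qed

section \<open>Lower exponential density of level sets\<close>

definition lower_exp_density :: "nat set \<Rightarrow> ereal" where
  "lower_exp_density S = liminf (\<lambda>N.
     ereal ((if S \<inter> {1..<N} = {} then 0 else ln (real (card (S \<inter> {1..<N})))) / ln (real N)))"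

definition approx_level_set :: "(nat \<Rightarrow> real) \<Rightarrow> real \<Rightarrow> real \<Rightarrow> nat set" where
  "approx_level_set f \<gamma> \<epsilon> =
     {n. 2 \<le> n \<and> \<gamma> - \<epsilon> \<le> ln (f n) / ln (real n) \<and> ln (f n) / ln (real n) \<le> \<gamma> + \<epsilon>}"

text \<open>
  The lower exponential density of the level set \<open>\<E>(\<gamma>)\<close> of \<open>f\<close>. The set \<open>\<E>(\<gamma>)\<close> is only
  determined up to the choice of a sequence of cut-off points, but its density does not
  depend on that choice: it is the limit of the densities of \<open>\<E>(\<gamma>,\<epsilon>)\<close> as \<open>\<epsilon> \<rightarrow> 0\<close>, which by
  monotonicity in \<open>\<epsilon>\<close> is their infimum.
\<close>

definition level_set_lower_exp_density :: "(nat \<Rightarrow> real) \<Rightarrow> real \<Rightarrow> ereal" where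
  "level_set_lower_exp_density f \<gamma> =
     (INF \<epsilon>\<in>{0<..}. lower_exp_density (approx_level_set f \<gamma> \<epsilon>))"

end

theory Submission
  imports Defs
begin

text \<open>
Write \<open>L = (d - 1) / (b - 1)\<close>, so that \<open>\<eta>\<close> is carried by \<open>[0, L]\<close>, and let \<open>N\<^sub>n(m)\<close> be the number of
representations of \<open>m\<close> with \<open>n\<close> digits. The first \<open>n\<close> digits of a random expansion \<open>X\<close>, read
backwards, represent an integer \<open>m\<close> with \<open>m \<le> b^n X \<le> m + L\<close>, and every string of \<open>n\<close> digits has
probability \<open>d^-n\<close>. Hence, up to constants, the measure of an interval of radius \<open>b^-n\<close> about \<open>x\<close> is
\<open>d^-n\<close> times the sum of \<open>N\<^sub>n(m)\<close> over the boundedly many integers \<open>m\<close> near \<open>b^n x\<close>. If \<open>\<eta>\<close> has local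
dimension \<open>\<alpha>\<close> at \<open>x\<close>, the largest of these \<open>N\<^sub>n(m)\<close> is therefore \<open>d^n b^(-n (\<alpha> + o(1)))\<close>, while
\<open>m\<close> is of the order of \<open>b^n\<close>; so \<open>ln N\<^sub>n(m) / ln m\<close> tends to \<open>\<gamma> = ln d / ln b - \<alpha>\<close>.

For \<open>x < 1\<close> one has \<open>m < b^n\<close> eventually and \<open>N\<^sub>n(m)\<close> is the full number \<open>N(m)\<close> of representations.
For larger \<open>x\<close> a representation of \<open>m\<close> may use more than \<open>n\<close> digits, but if \<open>0 < x < L\<close> this
changes the count by a bounded factor only (\<open>num_representations_le\<close>): since \<open>b \<le> d\<close>, the top part of a
longer representation denotes an integer that also has a representation short enough to fit into
\<open>n\<close> digits altogether, and a bounded number of top parts is exchanged for one.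

So every \<open>x\<close> in the level set, except possibly \<open>0\<close> and \<open>L\<close>, has the property that for all large \<open>n\<close> the
number \<open>b^n x\<close> is within distance \<open>d\<close> of an element \<open>m < b^(n+k)\<close> of \<open>\<E>(\<gamma>, \<epsilon>)\<close>, where \<open>k\<close> depends on
\<open>x\<close> (\<open>level_set_subset_scaled_neighbourhoods\<close>). If \<open>s\<close> exceeds the lower exponential density of
\<open>\<E>(\<gamma>, \<epsilon>)\<close>, then for infinitely many \<open>n\<close> there are only \<open>b^(n t)\<close> such \<open>m\<close>, up to a constant, with
\<open>t < s\<close>; intervals of length proportional to \<open>b^-n\<close> about the points \<open>m / b^n\<close> show that the
\<open>s\<close>-dimensional measure vanishes (\<open>hausdorff_null_scaled_neighbourhood\<close>). A countable union over
\<open>k\<close> and over the threshold for \<open>n\<close> finishes the argument.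
\<close>

section \<open>Sets of Hausdorff measure zero\<close>

lemma hausdorff_measure_eq_0_iff:
  "hausdorff_measure s A = 0 \<longleftrightarrow>
    (\<forall>\<delta>>0. \<forall>e>0. \<exists>U\<in>hausdorff_covers \<delta> A. (\<Sum>i. diam_gauge s (U i)) < ennreal e)"
  (is "?L \<longleftrightarrow> ?R")
proof
  assume ?L
  show ?R
  proof (intro allI impI)
    fix \<delta> e :: real assume "\<delta> > 0" "e > 0"
    have "(INF U\<in>hausdorff_covers \<delta> A. \<Sum>i. diam_gauge s (U i)) \<le> hausdorff_measure s A"
      unfolding hausdorff_measure_def using \<open>\<delta> > 0\<close> by (intro SUP_upper) auto
    also have "\<dots> < ennreal e" using \<open>?L\<close> \<open>e > 0\<close> by simp
    finally show "\<exists>U\<in>hausdorff_covers \<delta> A. (\<Sum>i. diam_gauge s (U i)) < ennreal e"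
      by (simp add: INF_less_iff)
  qed
next
  assume R: ?R
  have "hausdorff_measure s A \<le> 0"
    unfolding hausdorff_measure_def
  proof (intro SUP_least)
    fix \<delta> :: real assume "\<delta> \<in> {0<..}"
    show "(INF U\<in>hausdorff_covers \<delta> A. \<Sum>i. diam_gauge s (U i)) \<le> 0"
    proof (rule ennreal_le_epsilon)
      fix e :: real assume "e > 0"
      with R \<open>\<delta> \<in> {0<..}\<close>
      have "(INF U\<in>hausdorff_covers \<delta> A. \<Sum>i. diam_gauge s (U i)) < ennreal e"
        by (simp add: INF_less_iff)
      then show "(INF U\<in>hausdorff_covers \<delta> A. \<Sum>i. diam_gauge s (U i)) \<le> 0 + ennreal e"
        by simp
    qed
  qed
  then show ?L by simp
qed

lemma hausdorff_null_subset:
  assumes "hausdorff_measure s B = 0" "A \<subseteq> B"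
  shows "hausdorff_measure s A = 0"
proof -
  have "hausdorff_covers \<delta> B \<subseteq> hausdorff_covers \<delta> A" for \<delta>
    using assms(2) by (auto simp: hausdorff_covers_def)
  then show ?thesis
    using assms(1) unfolding hausdorff_measure_eq_0_iff by (meson subsetD)
qed

text \<open>
Spending \<open>e / 2^(i+2)\<close> on the \<open>i\<close>-th set leaves a total of \<open>e / 2 < e\<close>; the double sequence of covering sets
is enumerated by \<open>prod_decode\<close>.
\<close>

lemma hausdorff_null_UN:
  fixes A :: "nat \<Rightarrow> 'a::metric_space set"
  assumes "\<And>i. hausdorff_measure s (A i) = 0"
  shows "hausdorff_measure s (\<Union>i. A i) = 0"
  unfolding hausdorff_measure_eq_0_iff
proof (intro allI impI)
  fix \<delta> e :: real assume "\<delta> > 0" "e > 0"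
  have "\<exists>U\<in>hausdorff_covers \<delta> (A i).
      (\<Sum>j. diam_gauge s (U j)) < ennreal (e / 2 * (1/2) ^ Suc i)" for i
    using assms[of i] \<open>\<delta> > 0\<close> \<open>e > 0\<close> unfolding hausdorff_measure_eq_0_iff
    by (metis half_gt_zero mult_pos_pos zero_less_divide_1_iff zero_less_numeral zero_less_power)
  then obtain U where U: "\<And>i. U i \<in> hausdorff_covers \<delta> (A i)"
    and sumU: "\<And>i. (\<Sum>j. diam_gauge s (U i j)) < ennreal (e / 2 * (1/2) ^ Suc i)"
    by metis
  define V where "V n = case_prod U (prod_decode n)" for n
  have "(\<Union>i. A i) \<subseteq> (\<Union>n. V n)"
  proof
    fix x assume "x \<in> (\<Union>i. A i)"
    then obtain i where "x \<in> A i" by blast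
    with U[of i] obtain j where "x \<in> U i j"
      by (auto simp: hausdorff_covers_def)
    then have "x \<in> V (prod_encode (i, j))" by (simp add: V_def)
    then show "x \<in> (\<Union>n. V n)" by blast
  qed
  moreover have "bounded (V n) \<and> diameter (V n) \<le> \<delta>" for n
    using U by (auto simp: V_def hausdorff_covers_def split: prod.split)
  ultimately have V: "V \<in> hausdorff_covers \<delta> (\<Union>i. A i)"
    by (simp add: hausdorff_covers_def)
  have "(\<Sum>n. diam_gauge s (V n)) = (\<Sum>i. \<Sum>j. diam_gauge s (U i j))"
    using suminf_ennreal_2dimen[where f = "\<lambda>(i, j). diam_gauge s (U i j)",
        where g = "\<lambda>i. \<Sum>j. diam_gauge s (U i j)"]
    by (simp add: V_def comp_def case_prod_beta)
  also have "\<dots> \<le> (\<Sum>i. ennreal (e / 2 * (1/2) ^ Suc i))"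
    using sumU by (intro suminf_le) (auto intro: less_imp_le)
  also have "\<dots> = ennreal (e / 2)"
  proof -
    have "(\<lambda>i. e / 2 * (1/2) ^ Suc i) sums (e / 2 * 1)"
      by (intro sums_mult power_half_series)
    then show ?thesis
      using \<open>e > 0\<close> by (intro suminf_ennreal_eq) auto
  qed
  also have "\<dots> < ennreal e" using \<open>e > 0\<close> by (simp add: ennreal_less_iff)
  finally show "\<exists>U\<in>hausdorff_covers \<delta> (\<Union>i. A i). (\<Sum>i. diam_gauge s (U i)) < ennreal e"
    using V by blast
qed

text \<open>
Covers are indexed by all natural numbers, so a finite family is padded with empty sets, which have
gauge \<open>0\<close>.
\<close>

lemma hausdorff_null_finite_cover:
  fixes A :: "'a::metric_space set"
  assumes "\<And>\<delta> e. \<delta> > 0 \<Longrightarrow> e > 0 \<Longrightarrow> \<exists>F. finite F \<and> A \<subseteq> \<Union>F \<and>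
      (\<forall>B\<in>F. bounded B \<and> diameter B \<le> \<delta>) \<and> (\<Sum>B\<in>F. diam_gauge s B) < ennreal e"
  shows "hausdorff_measure s A = 0"
  unfolding hausdorff_measure_eq_0_iff
proof (intro allI impI)
  fix \<delta> e :: real assume "\<delta> > 0" "e > 0"
  then obtain F where F: "finite F" "A \<subseteq> \<Union>F" "\<And>B. B \<in> F \<Longrightarrow> bounded B \<and> diameter B \<le> \<delta>"
    "(\<Sum>B\<in>F. diam_gauge s B) < ennreal e"
    using assms by metis
  obtain h where h: "bij_betw h {..<card F} F"
    using bij_betw_from_nat_into_finite[OF F(1)] by blast
  define U where "U i = (if i < card F then h i else {})" for i
  have hF: "h i \<in> F" if "i < card F" for i
    using h that by (auto simp: bij_betw_def)
  have "A \<subseteq> (\<Union>i. U i)"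
  proof
    fix x assume "x \<in> A"
    then obtain B where "B \<in> F" "x \<in> B" using F(2) by blast
    then obtain i where "i < card F" "h i = B"
      using bij_betw_imp_surj_on[OF h] by (metis imageE lessThan_iff)
    then show "x \<in> (\<Union>i. U i)" using \<open>x \<in> B\<close> by (auto simp: U_def)
  qed
  then have "U \<in> hausdorff_covers \<delta> A"
    using hF F(3) \<open>\<delta> > 0\<close> by (auto simp: hausdorff_covers_def U_def)
  moreover have "(\<Sum>i. diam_gauge s (U i)) = (\<Sum>i<card F. diam_gauge s (U i))"
    by (intro suminf_finite) (auto simp: U_def diam_gauge_def)
  moreover have "\<dots> = (\<Sum>i<card F. diam_gauge s (h i))"
    by (intro sum.cong) (auto simp: U_def)
  moreover have "\<dots> = (\<Sum>B\<in>F. diam_gauge s B)"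
    by (rule sum.reindex_bij_betw[OF h])
  ultimately show "\<exists>U\<in>hausdorff_covers \<delta> A. (\<Sum>i. diam_gauge s (U i)) < ennreal e"
    using F(4) by (intro bexI[of _ U]) auto
qed

lemma hausdorff_null_singleton:
  fixes a :: "'a::metric_space"
  assumes "s > 0"
  shows "hausdorff_measure s {a} = 0"
proof (rule hausdorff_null_finite_cover, intro exI conjI)
  fix \<delta> e :: real assume "\<delta> > 0" "e > 0"
  show "(\<Sum>B\<in>{{a}}. diam_gauge s B) < ennreal e"
    using assms \<open>e > 0\<close> by (simp add: diam_gauge_def)
  show "\<forall>B\<in>{{a}}. bounded B \<and> diameter B \<le> \<delta>"
    using \<open>\<delta> > 0\<close> by simp
qed auto

lemma hausdorff_null_Un:
  assumes "hausdorff_measure s A = 0" "hausdorff_measure s B = 0"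
  shows "hausdorff_measure s (A \<union> B) = 0"
proof -
  have "hausdorff_measure s (\<Union>i::nat. if i = 0 then A else B) = 0"
    using assms by (intro hausdorff_null_UN) auto
  moreover have "A \<union> B \<subseteq> (\<Union>i::nat. if i = 0 then A else B)"
    by (auto intro: exI[of _ "1::nat"])
  ultimately show ?thesis by (rule hausdorff_null_subset)
qed

section \<open>Covering points that stay close to a sparse set of integers\<close>

lemma lower_exp_density_nonneg: "0 \<le> lower_exp_density S"
  unfolding lower_exp_density_def
proof (rule Liminf_bounded, rule eventually_sequentiallyI[of 1])
  fix N :: nat assume "1 \<le> N"
  have "1 \<le> card (S \<inter> {1..<N})" if "S \<inter> {1..<N} \<noteq> {}"
    using that by (simp add: Suc_le_eq card_gt_0_iff)
  then have "0 \<le> ln (real (card (S \<inter> {1..<N})))" if "S \<inter> {1..<N} \<noteq> {}"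
    using that by simp
  then show "0 \<le> ereal ((if S \<inter> {1..<N} = {} then 0 else ln (real (card (S \<inter> {1..<N})))) / ln (real N))"
    using \<open>1 \<le> N\<close> by simp
qed

text \<open>
A \<open>liminf\<close> only controls infinitely many \<open>N\<close>. This is enough for upper bounds on Hausdorff
measure, because a single sufficiently fine scale already provides a cover.
\<close>

lemma frequently_card_le_powr:
  assumes "lower_exp_density S < ereal t"
  shows "\<exists>\<^sub>F N in sequentially. real (card (S \<inter> {1..<N})) \<le> real N powr t"
proof -
  have "\<exists>\<^sub>F N in sequentially. ereal ((if S \<inter> {1..<N} = {} then 0
      else ln (real (card (S \<inter> {1..<N})))) / ln (real N)) < ereal t"
  proof (rule ccontr)
    assume "\<not> ?thesis"
    then have "ereal t \<le> lower_exp_density S"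
      unfolding lower_exp_density_def not_frequently
      by (intro Liminf_bounded) (simp add: not_less)
    with assms show False by simp
  qed
  then show ?thesis
  proof (rule frequently_rev_mp, intro eventually_mono[OF eventually_gt_at_top[of 1]] impI)
    fix N :: nat
    let ?c = "card (S \<inter> {1..<N})"
    assume "1 < N" and le: "ereal ((if S \<inter> {1..<N} = {} then 0
      else ln (real ?c)) / ln (real N)) < ereal t"
    show "real ?c \<le> real N powr t"
    proof (cases "S \<inter> {1..<N} = {}")
      case False
      then have "0 < ?c" by (simp add: card_gt_0_iff)
      have "ln (real ?c) < t * ln (real N)"
        using le False \<open>1 < N\<close> by (simp add: divide_less_eq)
      then have "exp (ln (real ?c)) \<le> real N powr t"
        using \<open>1 < N\<close> unfolding powr_def by simp
      then show ?thesis using \<open>0 < ?c\<close> by (subst (asm) exp_ln) simp_all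
    qed simp
  qed
qed

text \<open>
The points whose expansion to scale \<open>b^-n\<close> is, from \<open>n0\<close> on, always given by an element of \<open>S\<close>
up to a bounded error. The shift \<open>k\<close> admits points \<open>x\<close> that exceed \<open>1\<close>.
\<close>

definition scaled_neighbourhood :: "nat \<Rightarrow> real \<Rightarrow> nat set \<Rightarrow> nat \<Rightarrow> nat \<Rightarrow> real set" where
  "scaled_neighbourhood b R S k n0 =
     {x. \<forall>n\<ge>n0. \<exists>m\<in>S. 1 \<le> m \<and> m < b ^ (n + k) \<and> \<bar>real m - real b ^ n * x\<bar> \<le> R}"

text \<open>
At scale \<open>b^-n\<close> the set is covered by one interval of length \<open>2 R b^-n\<close> for each element of \<open>S\<close> below
\<open>b^(n+k)\<close>. Take \<open>t < s\<close> still above the density. For infinitely many \<open>n\<close> the number of intervals is at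
most \<open>b^((n+k+1) t)\<close>, and the sum of the gauges is at most a constant times \<open>b^(-n (s - t))\<close>.
\<close>

lemma hausdorff_null_scaled_neighbourhood:
  fixes R s :: real and b k n0 :: nat
  assumes "2 \<le> b" "0 \<le> R" "lower_exp_density S < ereal s"
  shows "hausdorff_measure s (scaled_neighbourhood b R S k n0) = 0"
    (is "hausdorff_measure s ?A = 0")
proof -
  obtain t where t: "lower_exp_density S < ereal t" "t < s"
    using ereal_dense2[OF assms(3)] by auto
  have "0 < t"
    using t(1) lower_exp_density_nonneg[of S] by (metis ereal_less(2) le_less_trans)
  define c where "c = real b powr ((k + 1) * t) * (2 * R) powr s"
  define u where "u n = real b powr (- real n * (s - t))" for n :: nat
  have b1: "1 < real b" using assms(1) by simp
  have "(\<lambda>n. 2 * R * (1 / real b) ^ n) \<longlonglongrightarrow> 2 * R * 0"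
    using b1 by (intro tendsto_mult tendsto_const LIMSEQ_power_zero) simp
  then have lim1: "(\<lambda>n. 2 * R / real b ^ n) \<longlonglongrightarrow> 0"
    by (subst (asm) power_one_over) simp
  have "u = (\<lambda>n. (real b powr (- (s - t))) ^ n)"
  proof
    show "u n = (real b powr (- (s - t))) ^ n" for n
      using b1 by (simp add: u_def powr_powr mult.commute[of "real n"] minus_mult_left del: mult_minus_left
        flip: powr_realpow)
  qed
  moreover have "\<bar>real b powr (- (s - t))\<bar> < 1"
    using b1 t(2) by (simp add: powr_less_one)
  ultimately have "u \<longlonglongrightarrow> 0"
    using LIMSEQ_power_zero[of "real b powr (- (s - t))"] by (metis real_norm_def)
  then have "(\<lambda>n. c * u n) \<longlonglongrightarrow> c * 0"
    by (intro tendsto_mult tendsto_const)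
  then have lim2: "(\<lambda>n. c * u n) \<longlonglongrightarrow> 0" by simp
  show ?thesis
  proof (rule hausdorff_null_finite_cover)
    fix \<delta> e :: real assume pos: "\<delta> > 0" "e > 0"
    have "\<forall>\<^sub>F n in sequentially. n \<ge> n0 \<and> 2 * R / real b ^ n < \<delta> \<and> c * u n < e"
      using order_tendstoD(2)[OF lim1 pos(1)] order_tendstoD(2)[OF lim2 pos(2)]
        eventually_ge_at_top[of n0] by eventually_elim auto
    then obtain n1 where n1: "\<And>n. n \<ge> n1 \<Longrightarrow> n \<ge> n0 \<and> 2 * R / real b ^ n < \<delta> \<and> c * u n < e"
      by (auto simp: eventually_sequentially)
    \<comment> \<open>The good bounds \<open>N\<close> need not be powers of \<open>b\<close>; rounding down to the power \<open>b^l\<close>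
      with \<open>b^l \<le> N < b^(l+1)\<close> costs a factor \<open>b^t\<close>, which is why \<open>k + 1\<close> occurs in \<open>c\<close>.\<close>
    obtain N where N: "N \<ge> b ^ (n1 + k)" "real (card (S \<inter> {1..<N})) \<le> real N powr t"
      using frequently_card_le_powr[OF t(1)] by (auto simp: frequently_sequentially)
    have "0 < N" using N(1) assms(1)
      by (metis gr0I le_zero_eq not_numeral_le_zero power_not_zero)
    obtain l where l: "b ^ l \<le> N" "N < b ^ (l + 1)"
      using ex_power_ivl1[OF assms(1), of N] \<open>0 < N\<close> by auto
    have "b ^ (n1 + k) < b ^ (l + 1)" using N(1) l(2) by linarith
    then have "n1 + k < l + 1"
      using assms(1) by (subst (asm) power_strict_increasing_iff) auto
    define n where "n = l - k"
    have ln: "l = n + k" "n \<ge> n1" using \<open>n1 + k < l + 1\<close> by (auto simp: n_def)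
    define M where "M = S \<inter> {1..<b ^ (n + k)}"
    define J where "J m = cball (real m / real b ^ n) (R / real b ^ n)" for m :: nat
    have "finite M" by (simp add: M_def)
    have diamJ: "diameter (J m) = 2 * R / real b ^ n" for m
      using assms(2) b1 by (simp add: J_def not_less[THEN iffD2])
    have cardM: "real (card M) \<le> real b powr ((real n + k + 1) * t)"
    proof -
      have "card M \<le> card (S \<inter> {1..<N})"
        using l(1) unfolding M_def ln(1) by (intro card_mono) auto
      then have "real (card M) \<le> real N powr t" using N(2) by linarith
      also have "\<dots> \<le> real (b ^ (l + 1)) powr t"
        using l(2) \<open>0 < t\<close> by (intro powr_mono2) (simp_all only: of_nat_le_iff of_nat_0_le_iff less_imp_le)
      also have "\<dots> = (real b powr (real n + k + 1)) powr t"
      proof -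
        have "real (b ^ (l + 1)) = real b powr real (l + 1)"
          using b1 by (subst powr_realpow) simp_all
        then show ?thesis using ln(1) by (simp add: add_ac)
      qed
      also have "\<dots> = real b powr ((real n + k + 1) * t)" by (simp add: powr_powr)
      finally show ?thesis .
    qed
    have "?A \<subseteq> \<Union>(J ` M)"
    proof
      fix x assume "x \<in> ?A"
      then obtain m where m: "m \<in> M" "\<bar>real m - real b ^ n * x\<bar> \<le> R"
        using n1[OF ln(2)] by (auto simp: M_def scaled_neighbourhood_def)
      have "\<bar>real m / real b ^ n - x\<bar> = \<bar>real m - real b ^ n * x\<bar> / real b ^ n"
        using b1 by (simp add: field_simps abs_divide flip: abs_mult)
      then have "x \<in> J m" using m(2) b1
        by (simp add: J_def dist_real_def divide_right_mono)
      then show "x \<in> \<Union>(J ` M)" using m(1) by blast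
    qed
    moreover have "\<forall>B\<in>J ` M. bounded B \<and> diameter B \<le> \<delta>"
      using diamJ n1[OF ln(2)] by (auto simp: J_def intro: less_imp_le)
    moreover have "(\<Sum>B\<in>J ` M. diam_gauge s B) < ennreal e"
    proof -
      have "s \<noteq> 0" using \<open>0 < t\<close> t(2) by simp
      then have gauge: "diam_gauge s (J m) = ennreal ((2 * R / real b ^ n) powr s)" for m
      proof -
        have "0 \<le> R / real b ^ n" using assms(2) by simp
        then have "J m \<noteq> {}" by (simp add: J_def)
        then show ?thesis using \<open>s \<noteq> 0\<close> by (simp add: diam_gauge_def diamJ)
      qed
      have "(\<Sum>B\<in>J ` M. diam_gauge s B) = of_nat (card (J ` M)) * ennreal ((2 * R / real b ^ n) powr s)"
        by (subst sum.cong[OF refl, of _ _ "\<lambda>_. ennreal ((2 * R / real b ^ n) powr s)"])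
          (auto simp: gauge)
      also have "\<dots> = ennreal (real (card (J ` M)) * (2 * R / real b ^ n) powr s)"
        by (simp add: ennreal_mult ennreal_of_nat_eq_real_of_nat)
      also have "\<dots> \<le> ennreal (c * u n)"
      proof (rule ennreal_leI)
        have "real (card (J ` M)) * (2 * R / real b ^ n) powr s
            \<le> real b powr ((real n + k + 1) * t) * (2 * R / real b ^ n) powr s"
          using cardM card_image_le[OF \<open>finite M\<close>, of J]
          by (intro mult_right_mono) auto
        also have "\<dots> = real b powr ((real n + k + 1) * t) * ((2 * R) powr s * real b powr (- (n * s)))"
          using b1 assms(2)
          by (simp add: powr_divide powr_powr powr_minus_divide flip: powr_realpow)
        also have "\<dots> = c * u n"
          by (simp add: c_def u_def algebra_simps flip: powr_add)
        finally show "real (card (J ` M)) * (2 * R / real b ^ n) powr s \<le> c * u n" .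
      qed
      also have "\<dots> < ennreal e" using n1[OF ln(2)] pos(2) by (simp add: ennreal_lessI)
      finally show ?thesis .
    qed
    ultimately show "\<exists>F. finite F \<and> ?A \<subseteq> \<Union>F \<and>
      (\<forall>B\<in>F. bounded B \<and> diameter B \<le> \<delta>) \<and> (\<Sum>B\<in>F. diam_gauge s B) < ennreal e"
      using \<open>finite M\<close> by (intro exI[of _ "J ` M"]) simp
  qed
qed

section \<open>Representations with a bounded number of digits\<close>

text \<open>
Strings of \<open>n\<close> digits are functions that vanish from \<open>n\<close> on, least significant digit first, so that
they are literally representations of their values.
\<close>

definition digit_strings :: "nat \<Rightarrow> nat \<Rightarrow> (nat \<Rightarrow> nat) set" where
  "digit_strings d n = {w. (\<forall>i. w i < d) \<and> (\<forall>i\<ge>n. w i = 0)}"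

definition digits_value :: "nat \<Rightarrow> nat \<Rightarrow> (nat \<Rightarrow> nat) \<Rightarrow> nat" where
  "digits_value b n w = (\<Sum>i<n. w i * b ^ i)"

definition short_representations :: "nat \<Rightarrow> nat \<Rightarrow> nat \<Rightarrow> nat \<Rightarrow> (nat \<Rightarrow> nat) set" where
  "short_representations b d n m = {w \<in> digit_strings d n. digits_value b n w = m}"

lemma
  assumes "0 < d"
  shows finite_digit_strings: "finite (digit_strings d n)"
    and card_digit_strings: "card (digit_strings d n) = d ^ n"
proof -
  have eq: "digit_strings d n = (\<lambda>f i. if i < n then f i else 0) ` ({..<n} \<rightarrow>\<^sub>E {..<d})" (is "_ = ?e ` _")
  proof (intro equalityI subsetI)
    fix w assume "w \<in> digit_strings d n"
    then have "w = ?e (restrict w {..<n})" "restrict w {..<n} \<in> {..<n} \<rightarrow>\<^sub>E {..<d}"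
      by (auto simp: digit_strings_def fun_eq_iff)
    then show "w \<in> ?e ` ({..<n} \<rightarrow>\<^sub>E {..<d})" by blast
  next
    fix w assume "w \<in> ?e ` ({..<n} \<rightarrow>\<^sub>E {..<d})"
    then obtain f where f: "f \<in> {..<n} \<rightarrow>\<^sub>E {..<d}" "w = ?e f" by blast
    have "f i < d" if "i < n" for i
      using PiE_mem[OF f(1), of i] that by simp
    then show "w \<in> digit_strings d n"
      using assms by (simp add: digit_strings_def f(2))
  qed
  have "inj_on ?e ({..<n} \<rightarrow>\<^sub>E {..<d})"
  proof (rule inj_onI)
    fix f g assume f: "f \<in> {..<n} \<rightarrow>\<^sub>E {..<d}" and g: "g \<in> {..<n} \<rightarrow>\<^sub>E {..<d}" and "?e f = ?e g"
    have "f i = g i" if "i < n" for i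
      using fun_cong[OF \<open>?e f = ?e g\<close>, of i] that by simp
    then show "f = g" using f g by (intro PiE_ext) auto
  qed
  then show "finite (digit_strings d n)" "card (digit_strings d n) = d ^ n"
    unfolding eq by (auto simp: card_image card_PiE intro: finite_PiE)
qed

lemma digits_value_cong:
  "(\<And>i. i < n \<Longrightarrow> v i = w i) \<Longrightarrow> digits_value b n v = digits_value b n w"
  by (simp add: digits_value_def)

lemma finite_short_representations: "0 < d \<Longrightarrow> finite (short_representations b d n m)"
  by (simp add: short_representations_def finite_digit_strings)

lemma digits_value_append:
  "digits_value b (p + q) w = digits_value b p w + b ^ p * digits_value b q (\<lambda>i. w (p + i))"
proof -
  have "digits_value b (p + q) w = (\<Sum>i<p. w i * b ^ i) + (\<Sum>i=p..<p+q. w i * b ^ i)"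
    unfolding digits_value_def by (simp add: lessThan_atLeast0 sum.atLeastLessThan_concat)
  also have "(\<Sum>i=p..<p+q. w i * b ^ i) = (\<Sum>i<q. w (p + i) * b ^ (p + i))"
    using sum.shift_bounds_nat_ivl[of "\<lambda>i. w i * b ^ i" 0 p q]
    by (simp add: lessThan_atLeast0 add.commute)
  also have "\<dots> = b ^ p * digits_value b q (\<lambda>i. w (p + i))"
    by (simp add: digits_value_def sum_distrib_left power_add mult_ac)
  finally show ?thesis by (simp add: digits_value_def)
qed

text \<open>
The largest value of \<open>n\<close> digits is \<open>(b^n - 1) (d - 1) / (b - 1)\<close>, and \<open>b \<le> d\<close> leaves no gaps below it.
The top digit is chosen greedily: if it is the maximal digit \<open>d - 1\<close>, the bound for \<open>n + 1\<close> digits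
turns into that for \<open>n\<close> digits; otherwise the remainder is less than \<open>b^n\<close>, hence at most
\<open>b^n - 1 \<le> (b^n - 1) (d - 1) / (b - 1)\<close>.
\<close>

lemma ex_short_representation:
  assumes "2 \<le> b" "b \<le> d" "m * (b - 1) \<le> (b ^ n - 1) * (d - 1)"
  shows "short_representations b d n m \<noteq> {}"
  using assms(3)
proof (induction n arbitrary: m)
  case 0
  then have "m = 0" using assms(1) by simp
  then have "(\<lambda>_. 0) \<in> short_representations b d 0 m"
    using assms(1,2) by (simp add: short_representations_def digit_strings_def digits_value_def)
  then show ?case by blast
next
  case (Suc n)
  define c where "c = min (d - 1) (m div b ^ n)"
  have cb: "c * b ^ n \<le> m"
    by (metis c_def div_times_less_eq_dividend le_trans min.cobounded2 mult_le_mono1)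
  have bn: "1 \<le> b ^ n" using assms(1) by simp
  have "(m - c * b ^ n) * (b - 1) \<le> (b ^ n - 1) * (d - 1)"
  proof (cases "m div b ^ n \<le> d - 1")
    case True
    then have "m - c * b ^ n = m mod b ^ n" by (simp add: c_def minus_div_mult_eq_mod)
    then have "m - c * b ^ n \<le> b ^ n - 1" using bn
      by (metis Suc_pred' less_Suc_eq_le less_le_trans mod_less_divisor zero_less_one)
    then show ?thesis using assms(2) by (intro mult_le_mono) auto
  next
    case False
    then have c: "c = d - 1" by (simp add: c_def)
    have "int ((m - c * b ^ n) * (b - 1)) \<le> int ((b ^ n - 1) * (d - 1))"
    proof -
      have "int (m * (b - 1)) \<le> int ((b ^ Suc n - 1) * (d - 1))" using Suc.prems by presburger
      then have "int m * (int b - 1) \<le> (int b * int b ^ n - 1) * (int d - 1)"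
        using assms(1,2) by (simp add: of_nat_diff Suc_le_eq)
      then have "(int m - (int d - 1) * int b ^ n) * (int b - 1) \<le> (int b ^ n - 1) * (int d - 1)"
        by (simp add: algebra_simps)
      moreover have "int (m - c * b ^ n) = int m - (int d - 1) * int b ^ n"
        using cb assms(1,2) unfolding c by (simp add: of_nat_diff)
      ultimately show ?thesis using assms(1,2) bn by (simp add: of_nat_diff)
    qed
    then show ?thesis by linarith
  qed
  from Suc.IH[OF this] obtain w where w: "w \<in> digit_strings d n" "digits_value b n w = m - c * b ^ n"
    by (auto simp: short_representations_def)
  have "c < d" using assms(1,2) by (auto simp: c_def)
  have "digits_value b n (w(n := c)) = digits_value b n w"
    by (rule digits_value_cong) simp
  then have "digits_value b (Suc n) (w(n := c)) = m"
    using w(2) cb by (simp add: digits_value_def)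
  moreover have "w(n := c) \<in> digit_strings d (Suc n)"
    using w(1) \<open>c < d\<close> by (auto simp: digit_strings_def)
  ultimately show ?case by (auto simp: short_representations_def)
qed

lemma short_representations_subset:
  "short_representations b d n m \<subseteq> representations b d m"
proof
  fix w assume w: "w \<in> short_representations b d n m"
  then have "w i = 0" if "n \<le> i" for i
    using that by (simp add: short_representations_def digit_strings_def)
  then have "{i. w i \<noteq> 0} \<subseteq> {..<n}"
    by (metis (mono_tags) leI lessThan_iff mem_Collect_eq subsetI)
  then have "(\<Sum>i | w i \<noteq> 0. w i * b ^ i) = (\<Sum>i<n. w i * b ^ i)"
    by (intro sum.mono_neutral_left) auto
  then show "w \<in> representations b d m"
    using w finite_subset[OF \<open>{i. w i \<noteq> 0} \<subseteq> {..<n}\<close>]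
    by (auto simp: short_representations_def digit_strings_def representations_def digits_value_def)
qed

text \<open>
A nonzero digit at a position \<open>i \<ge> n\<close> would already contribute at least \<open>b^n > m\<close>.
\<close>

lemma representations_eq_short:
  assumes "0 < b" "m < b ^ n"
  shows "representations b d m = short_representations b d n m"
proof
  show "representations b d m \<subseteq> short_representations b d n m"
  proof
    fix w assume w: "w \<in> representations b d m"
    have zero: "w i = 0" if "n \<le> i" for i
    proof (rule ccontr)
      assume "w i \<noteq> 0"
      have "b ^ n \<le> b ^ i" using \<open>0 < b\<close> that by (intro power_increasing) auto
      also have "\<dots> \<le> w i * b ^ i" using \<open>w i \<noteq> 0\<close> by simp
      also have "\<dots> \<le> (\<Sum>i | w i \<noteq> 0. w i * b ^ i)"
        using w \<open>w i \<noteq> 0\<close> by (intro member_le_sum) (auto simp: representations_def)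
      also have "\<dots> = m" using w by (simp add: representations_def)
      finally show False using assms by simp
    qed
    have "(\<Sum>i | w i \<noteq> 0. w i * b ^ i) = (\<Sum>i<n. w i * b ^ i)"
    proof (intro sum.mono_neutral_left)
      show "{i. w i \<noteq> 0} \<subseteq> {..<n}"
        using zero by (metis (mono_tags) leI lessThan_iff mem_Collect_eq subsetI)
    qed auto
    then show "w \<in> short_representations b d n m"
      using w zero
      by (auto simp: short_representations_def digit_strings_def representations_def digits_value_def)
  qed
qed (rule short_representations_subset)

text \<open>
Split a representation of \<open>m\<close> into its \<open>p\<close> lowest digits and a top part with \<open>q + k\<close> digits. The value \<open>u\<close>
of the top part satisfies \<open>b^p u \<le> m\<close>, so by the size condition on \<open>m\<close> it has a representation with only
\<open>q\<close> digits. Replacing the top part by one fixed such representation yields a representation of \<open>m\<close>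
with \<open>p + q\<close> digits. The original is recovered from the new one together with the old top part, for
which there are \<open>d^(k+q)\<close> possibilities.
\<close>

lemma num_representations_le:
  assumes "2 \<le> b" "b \<le> d"
    and "m < b ^ (p + q + k)" "m * (b - 1) \<le> b ^ p * ((b ^ q - 1) * (d - 1))"
  shows "num_representations b d m \<le> d ^ (k + q) * card (short_representations b d (p + q) m)"
proof -
  have "0 < d" using assms by simp
  define top where "top w i = w (p + i)" for w :: "nat \<Rightarrow> nat" and i
  define r where "r u = (SOME w. w \<in> short_representations b d q u)" for u
  define swap where "swap w i = (if i < p then w i else if i < p + q
     then r (digits_value b (q + k) (top w)) (i - p) else 0)" for w i
  let ?S = "short_representations b d (p + q + k) m"
  have top: "top w \<in> digit_strings d (q + k)" if "w \<in> ?S" for w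
    using that by (simp add: short_representations_def digit_strings_def top_def)
  have value_split: "m = digits_value b p w + b ^ p * digits_value b (q + k) (top w)" if "w \<in> ?S" for w
    using that digits_value_append[of b p "q + k" w]
    by (simp add: short_representations_def top_def[abs_def] add.assoc)
  have r: "r (digits_value b (q + k) (top w)) \<in> short_representations b d q (digits_value b (q + k) (top w))"
    if "w \<in> ?S" for w
  proof -
    let ?u = "digits_value b (q + k) (top w)"
    have "b ^ p * (?u * (b - 1)) \<le> m * (b - 1)"
    proof -
      have "b ^ p * ?u \<le> m" using value_split[OF that] by linarith
      then show ?thesis unfolding mult.assoc[symmetric] by (rule mult_le_mono1)
    qed
    then have "b ^ p * (?u * (b - 1)) \<le> b ^ p * ((b ^ q - 1) * (d - 1))"
      using assms(4) by linarith
    then have "?u * (b - 1) \<le> (b ^ q - 1) * (d - 1)"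
      using assms(1) by simp
    then have "short_representations b d q ?u \<noteq> {}"
      by (rule ex_short_representation[OF assms(1,2)])
    then show ?thesis unfolding r_def by (rule some_in_eq[THEN iffD2])
  qed
  have swap: "swap w \<in> short_representations b d (p + q) m" if "w \<in> ?S" for w
  proof -
    let ?u = "digits_value b (q + k) (top w)"
    have "digits_value b (p + q) (swap w)
        = digits_value b p (swap w) + b ^ p * digits_value b q (\<lambda>i. swap w (p + i))"
      by (rule digits_value_append)
    also have "digits_value b p (swap w) = digits_value b p w"
      by (rule digits_value_cong) (simp add: swap_def)
    also have "digits_value b q (\<lambda>i. swap w (p + i)) = digits_value b q (r ?u)"
      by (rule digits_value_cong) (simp add: swap_def)
    also have "\<dots> = ?u" using r[OF that] by (simp add: short_representations_def)
    finally have "digits_value b (p + q) (swap w) = m"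
      using value_split[OF that] by linarith
    moreover have "swap w \<in> digit_strings d (p + q)"
    proof -
      have "w i < d" "r ?u i < d" for i
        using that r[OF that] by (simp_all add: short_representations_def digit_strings_def)
      then show ?thesis
        using \<open>0 < d\<close> by (simp add: digit_strings_def swap_def)
    qed
    ultimately show ?thesis by (simp add: short_representations_def)
  qed
  have "inj_on (\<lambda>w. (top w, swap w)) ?S"
  proof (rule inj_onI)
    fix v w assume "(top v, swap v) = (top w, swap w)"
    then have eq: "top v = top w" "swap v = swap w" by auto
    show "v = w"
    proof
      fix i
      show "v i = w i"
      proof (cases "i < p")
        case True
        then show ?thesis using fun_cong[OF eq(2), of i] by (simp add: swap_def)
      next
        case False
        then show ?thesis using fun_cong[OF eq(1), of "i - p"] by (simp add: top_def)
      qed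
    qed
  qed
  moreover have "(\<lambda>w. (top w, swap w)) ` ?S \<subseteq> digit_strings d (q + k) \<times> short_representations b d (p + q) m"
    using top swap by blast
  moreover have "finite (digit_strings d (q + k) \<times> short_representations b d (p + q) m)"
    using \<open>0 < d\<close> by (simp add: finite_digit_strings finite_short_representations)
  ultimately have "card ?S \<le> card (digit_strings d (q + k) \<times> short_representations b d (p + q) m)"
    by (rule card_inj_on_le)
  then show ?thesis
    using representations_eq_short[OF _ assms(3), of d] assms(1) \<open>0 < d\<close>
    by (simp add: num_representations_def card_cartesian_product card_digit_strings add.commute)
qed

section \<open>Measures of intervals as numbers of representations\<close>

text \<open>
Digits of \<open>\<omega>\<close> have decreasing weights \<open>b^-1, b^-2, \<dots>\<close>, digits of an integer increasing ones. Reversing the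
first \<open>n\<close> digits gives the string whose value is \<open>b^n\<close> times the truncated expansion.
\<close>

definition reversed_prefix :: "nat \<Rightarrow> (nat \<Rightarrow> nat) \<Rightarrow> nat \<Rightarrow> nat" where
  "reversed_prefix n \<omega> = (\<lambda>i. if i < n then \<omega> (n - Suc i) else 0)"

abbreviation uniform_digits :: "nat \<Rightarrow> (nat \<Rightarrow> nat) measure" where
  "uniform_digits d \<equiv> digit_measure d (\<lambda>_. 1 / real d)"

abbreviation uniform_convolution :: "nat \<Rightarrow> nat \<Rightarrow> real measure" where
  "uniform_convolution b d \<equiv> bernoulli_convolution b d (\<lambda>_. 1 / real d)"

lemma in_space_digit_measure_iff: "\<omega> \<in> space (digit_measure d p) \<longleftrightarrow> (\<forall>k. \<omega> k < d)"
  by (auto simp: digit_measure_def space_PiM space_point_measure PiE_iff)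

lemma prob_space_uniform_digit:
  assumes "0 < d"
  shows "prob_space (point_measure {..<d} (\<lambda>i. ennreal (1 / real d)))"
proof (rule prob_spaceI)
  have "(\<Sum>i<d. ennreal (1 / real d)) = ennreal (\<Sum>i<d. 1 / real d)"
    by (rule sum_ennreal) simp
  then have "(\<Sum>i<d. ennreal (1 / real d)) = 1" using assms by simp
  then show "emeasure (point_measure {..<d} (\<lambda>i. ennreal (1 / real d)))
      (space (point_measure {..<d} (\<lambda>i. ennreal (1 / real d)))) = 1"
    by (simp only: space_point_measure emeasure_point_measure_finite finite_lessThan order_refl)
qed

lemma prob_space_uniform_digits:
  assumes "0 < d"
  shows "prob_space (uniform_digits d)"
  unfolding digit_measure_def using prob_space_uniform_digit[OF assms] by (rule prob_space_PiM)

text \<open>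
Fixing the first \<open>n\<close> digits describes a cylinder of the product space.
\<close>

lemma
  assumes "0 < d" "w \<in> digit_strings d n"
  shows sets_reversed_prefix_eq:
      "{\<omega> \<in> space (uniform_digits d). reversed_prefix n \<omega> = w} \<in> sets (uniform_digits d)"
    and prob_reversed_prefix_eq:
      "measure (uniform_digits d) {\<omega> \<in> space (uniform_digits d). reversed_prefix n \<omega> = w} = 1 / real d ^ n"
proof -
  define M where "M = point_measure {..<d} (\<lambda>i. ennreal (1 / real d))"
  interpret M: prob_space M
    unfolding M_def by (rule prob_space_uniform_digit[OF assms(1)])
  interpret product_prob_space "\<lambda>_::nat. M" UNIV
    by (intro product_prob_spaceI M.prob_space_axioms)
  have w: "w i < d" "n \<le> i \<Longrightarrow> w i = 0" for i
    using assms(2) by (simp_all add: digit_strings_def)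
  have P: "uniform_digits d = Pi\<^sub>M UNIV (\<lambda>_. M)"
    by (simp add: digit_measure_def M_def)
  let ?X = "\<lambda>k. {w (n - Suc k)}"
  have cylinder: "{\<omega> \<in> space (uniform_digits d). reversed_prefix n \<omega> = w}
      = prod_emb UNIV (\<lambda>_. M) {..<n} (Pi\<^sub>E {..<n} ?X)"
  proof (intro equalityI subsetI)
    fix \<omega> assume "\<omega> \<in> {\<omega> \<in> space (uniform_digits d). reversed_prefix n \<omega> = w}"
    then have \<omega>: "\<omega> \<in> space (uniform_digits d)" "w = reversed_prefix n \<omega>" by auto
    have "restrict \<omega> {..<n} \<in> Pi\<^sub>E {..<n} ?X"
      unfolding \<omega>(2) by (rule PiE_I) (simp_all add: reversed_prefix_def Suc_diff_Suc)
    then show "\<omega> \<in> prod_emb UNIV (\<lambda>_. M) {..<n} (Pi\<^sub>E {..<n} ?X)"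
      using \<omega>(1) by (simp add: prod_emb_def P space_PiM)
  next
    fix \<omega> assume "\<omega> \<in> prod_emb UNIV (\<lambda>_. M) {..<n} (Pi\<^sub>E {..<n} ?X)"
    then have \<omega>: "\<omega> \<in> space (uniform_digits d)" "restrict \<omega> {..<n} \<in> Pi\<^sub>E {..<n} ?X"
      by (simp_all add: prod_emb_def P space_PiM)
    have "reversed_prefix n \<omega> i = w i" for i
      using PiE_mem[OF \<omega>(2), of "n - Suc i"] w(2)[of i]
      by (cases "i < n") (simp_all add: reversed_prefix_def Suc_diff_Suc)
    then show "\<omega> \<in> {\<omega> \<in> space (uniform_digits d). reversed_prefix n \<omega> = w}"
      using \<omega>(1) by auto
  qed
  have digit: "measure M {j} = 1 / real d" if "j < d" for j
    using that by (simp add: M_def measure_def emeasure_point_measure_finite)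
  have setsM: "{j} \<in> sets M" if "j < d" for j
    using that by (simp add: M_def)
  show "{\<omega> \<in> space (uniform_digits d). reversed_prefix n \<omega> = w} \<in> sets (uniform_digits d)"
    unfolding cylinder unfolding P using setsM w(1) by (intro sets_PiM_I) auto
  have "measure (Pi\<^sub>M UNIV (\<lambda>_. M)) (prod_emb UNIV (\<lambda>_. M) {..<n} (Pi\<^sub>E {..<n} ?X))
      = (\<Prod>k<n. measure M (?X k))"
    using setsM w(1) by (intro measure_PiM_emb) auto
  then show "measure (uniform_digits d) {\<omega> \<in> space (uniform_digits d). reversed_prefix n \<omega> = w}
      = 1 / real d ^ n"
    unfolding cylinder unfolding P using digit w(1) by (simp add: power_one_over)
qed

lemma reversed_prefix_in_digit_strings:
  assumes "\<omega> \<in> space (digit_measure d p)"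
  shows "reversed_prefix n \<omega> \<in> digit_strings d n"
proof -
  have "\<omega> k < d" for k using assms by (simp add: in_space_digit_measure_iff)
  then show ?thesis
    by (simp add: digit_strings_def reversed_prefix_def le_less_trans[OF le0 \<open>\<omega> 0 < d\<close>])
qed

lemma
  assumes "0 < d" "A \<subseteq> digit_strings d n"
  shows sets_reversed_prefix:
      "{\<omega> \<in> space (uniform_digits d). reversed_prefix n \<omega> \<in> A} \<in> sets (uniform_digits d)"
    and prob_reversed_prefix:
      "measure (uniform_digits d) {\<omega> \<in> space (uniform_digits d). reversed_prefix n \<omega> \<in> A}
        = real (card A) / real d ^ n"
proof -
  interpret prob_space "uniform_digits d"
    by (rule prob_space_uniform_digits[OF assms(1)])
  let ?E = "\<lambda>w. {\<omega> \<in> space (uniform_digits d). reversed_prefix n \<omega> = w}"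
  have "finite A" using assms finite_digit_strings finite_subset by metis
  have eq: "{\<omega> \<in> space (uniform_digits d). reversed_prefix n \<omega> \<in> A} = (\<Union>w\<in>A. ?E w)"
    by blast
  have sets: "?E ` A \<subseteq> sets (uniform_digits d)"
    using sets_reversed_prefix_eq[OF assms(1)] assms(2) by blast
  then show "{\<omega> \<in> space (uniform_digits d). reversed_prefix n \<omega> \<in> A} \<in> sets (uniform_digits d)"
    unfolding eq using \<open>finite A\<close> by (intro sets.finite_UN) auto
  have "disjoint_family_on ?E A" by (auto simp: disjoint_family_on_def)
  then have "prob (\<Union>w\<in>A. ?E w) = (\<Sum>w\<in>A. prob (?E w))"
    by (rule finite_measure_finite_Union[OF \<open>finite A\<close> sets])
  also have "\<dots> = (\<Sum>w\<in>A. 1 / real d ^ n)"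
    using assms(2) by (intro sum.cong prob_reversed_prefix_eq[OF assms(1)]) auto
  finally show "prob {\<omega> \<in> space (uniform_digits d). reversed_prefix n \<omega> \<in> A} = real (card A) / real d ^ n"
    unfolding eq by simp
qed

text \<open>
Multiplication by \<open>b^n\<close> turns the first \<open>n\<close> terms into an integer and leaves a tail of the same form as
the whole series, which lies between \<open>0\<close> and the geometric sum \<open>(d - 1) / (b - 1)\<close>.
\<close>

lemma base_expansion_bounds:
  assumes "2 \<le> b" "\<And>k. \<omega> k < d"
  shows "real (digits_value b n (reversed_prefix n \<omega>)) \<le> real b ^ n * base_expansion b \<omega>"
    and "real b ^ n * base_expansion b \<omega>
      \<le> real (digits_value b n (reversed_prefix n \<omega>)) + (real d - 1) / (real b - 1)"
proof -
  let ?f = "\<lambda>k. real (\<omega> k) / real b ^ Suc k"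
  have b1: "1 < real b" using assms(1) by simp
  have digit: "real (\<omega> k) \<le> real d - 1" for k
  proof -
    have "Suc (\<omega> k) \<le> d" using assms(2)[of k] by simp
    then have "real (Suc (\<omega> k)) \<le> real d" by (simp only: of_nat_le_iff)
    then show ?thesis by simp
  qed
  have geo: "(\<lambda>k. (1 / real b) ^ Suc k) sums (1 / (real b - 1))"
  proof -
    have "(\<lambda>k. (1 / real b) * (1 / real b) ^ k) sums ((1 / real b) * (1 / (1 - 1 / real b)))"
      using b1 by (intro sums_mult geometric_sums) simp
    then show ?thesis using b1 by (simp add: field_simps)
  qed
  have bound: "real (\<omega> j) / real b ^ Suc k \<le> (real d - 1) * (1 / real b) ^ Suc k" for j k
    unfolding power_one_over times_divide_eq_right mult_1_right
    using digit[of j] by (rule divide_right_mono) simp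
  have summable: "summable ?f"
  proof (rule summable_comparison_test')
    show "summable (\<lambda>k. (real d - 1) * (1 / real b) ^ Suc k)"
      using geo by (intro summable_mult) (rule sums_summable)
    show "norm (?f k) \<le> (real d - 1) * (1 / real b) ^ Suc k" for k
      using bound[of k k] by simp
  qed
  define T where "T = (\<Sum>k. real (\<omega> (k + n)) / real b ^ Suc k)"
  have tail: "real b ^ n * (\<Sum>k. ?f (k + n)) = T"
  proof -
    have "summable (\<lambda>k. ?f (k + n))" using summable by (rule summable_ignore_initial_segment)
    then have "(\<Sum>k. real b ^ n * ?f (k + n)) = real b ^ n * (\<Sum>k. ?f (k + n))"
      by (rule suminf_mult)
    moreover have "real b ^ n * ?f (k + n) = real (\<omega> (k + n)) / real b ^ Suc k" for k
      using b1 by (simp add: power_add)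
    ultimately show ?thesis unfolding T_def by (simp only:)
  qed
  have sT: "summable (\<lambda>k. real (\<omega> (k + n)) / real b ^ Suc k)"
  proof (rule summable_comparison_test')
    show "summable (\<lambda>k. (real d - 1) * (1 / real b) ^ Suc k)"
      using geo by (intro summable_mult) (rule sums_summable)
    show "norm (real (\<omega> (k + n)) / real b ^ Suc k) \<le> (real d - 1) * (1 / real b) ^ Suc k" for k
      using bound[of "k + n" k] by simp
  qed
  have T0: "0 \<le> T" unfolding T_def using sT by (intro suminf_nonneg) auto
  have T1: "T \<le> (real d - 1) / (real b - 1)"
  proof -
    have s: "(\<lambda>k. (real d - 1) * (1 / real b) ^ Suc k) sums ((real d - 1) * (1 / (real b - 1)))"
      using geo by (rule sums_mult)
    have "T \<le> (\<Sum>k. (real d - 1) * (1 / real b) ^ Suc k)"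
      unfolding T_def
    proof (rule suminf_le[OF _ sT sums_summable[OF s]])
      show "real (\<omega> (k + n)) / real b ^ Suc k \<le> (real d - 1) * (1 / real b) ^ Suc k" for k
        by (rule bound)
    qed
    then show ?thesis using sums_unique[OF s] by simp
  qed
  have head: "real b ^ n * (\<Sum>k<n. ?f k) = real (digits_value b n (reversed_prefix n \<omega>))"
  proof -
    have "real (digits_value b n (reversed_prefix n \<omega>)) = (\<Sum>i<n. real (\<omega> (n - Suc i)) * real b ^ i)"
      by (simp add: digits_value_def reversed_prefix_def)
    also have "\<dots> = (\<Sum>i<n. real (\<omega> (n - Suc i)) * real b ^ (n - Suc (n - Suc i)))"
      by (intro sum.cong) (auto simp: Suc_diff_Suc)
    also have "\<dots> = (\<Sum>k<n. real (\<omega> k) * real b ^ (n - Suc k))"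
      by (rule sum.nat_diff_reindex)
    also have "\<dots> = (\<Sum>k<n. real b ^ n * ?f k)"
    proof (rule sum.cong)
      fix k assume "k \<in> {..<n}"
      then have "real b ^ n = real b ^ (n - Suc k) * real b ^ Suc k"
        by (metis Suc_leI le_add_diff_inverse2 lessThan_iff power_add)
      then show "real (\<omega> k) * real b ^ (n - Suc k) = real b ^ n * ?f k"
        using b1 by (simp del: power_Suc)
    qed simp
    finally show ?thesis by (simp add: sum_distrib_left)
  qed
  have "base_expansion b \<omega> = (\<Sum>k. ?f (k + n)) + (\<Sum>k<n. ?f k)"
    unfolding base_expansion_def by (rule suminf_split_initial_segment[OF summable])
  then have "real b ^ n * base_expansion b \<omega> = T + real b ^ n * (\<Sum>k<n. ?f k)"
    by (simp only: tail distrib_left)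
  then have main: "real b ^ n * base_expansion b \<omega> = T + real (digits_value b n (reversed_prefix n \<omega>))"
    by (simp only: head)
  show "real (digits_value b n (reversed_prefix n \<omega>)) \<le> real b ^ n * base_expansion b \<omega>"
    using main T0 by linarith
  show "real b ^ n * base_expansion b \<omega>
      \<le> real (digits_value b n (reversed_prefix n \<omega>)) + (real d - 1) / (real b - 1)"
    using main T1 by linarith
qed

lemma measure_uniform_convolution:
  assumes "B \<in> sets borel"
  shows "measure (uniform_convolution b d) B
    = measure (uniform_digits d) {\<omega> \<in> space (uniform_digits d). base_expansion b \<omega> \<in> B}"
proof -
  have "measure (uniform_convolution b d) B
      = measure (uniform_digits d) (base_expansion b -` B \<inter> space (uniform_digits d))"
    unfolding bernoulli_convolution_def
    by (rule measure_distr[OF base_expansion_measurable assms])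
  also have "base_expansion b -` B \<inter> space (uniform_digits d)
      = {\<omega> \<in> space (uniform_digits d). base_expansion b \<omega> \<in> B}" by blast
  finally show ?thesis .
qed

lemma sets_base_expansion:
  "B \<in> sets borel \<Longrightarrow> {\<omega> \<in> space (digit_measure d p). base_expansion b \<omega> \<in> B} \<in> sets (digit_measure d p)"
  using measurable_sets[OF base_expansion_measurable, of B b d p]
  by (simp add: vimage_def Int_def conj_commute)

text \<open>
Every expansion lies in \<open>[0, (d - 1) / (b - 1)]\<close> (the case \<open>n = 0\<close> of the bounds above), so a point at
distance \<open>r > 0\<close> from this interval has a null neighbourhood of radius \<open>r\<close>.
\<close>

lemma support_uniform_convolution:
  assumes "2 \<le> b" and pos: "\<And>r. r > 0 \<Longrightarrow> 0 < measure (uniform_convolution b d) {x - r<..<x + r}"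
  shows "0 \<le> x" "x \<le> (real d - 1) / (real b - 1)"
proof -
  have "\<exists>y \<in> {x - r<..<x + r}. 0 \<le> y \<and> y \<le> (real d - 1) / (real b - 1)" if "r > 0" for r
  proof -
    have "{\<omega> \<in> space (uniform_digits d). base_expansion b \<omega> \<in> {x - r<..<x + r}} \<noteq> {}"
    proof
      assume "{\<omega> \<in> space (uniform_digits d). base_expansion b \<omega> \<in> {x - r<..<x + r}} = {}"
      then have "measure (uniform_convolution b d) {x - r<..<x + r} = 0"
        by (simp only: measure_uniform_convolution borel_open open_greaterThanLessThan measure_empty)
      then show False using pos[OF that] by simp
    qed
    then obtain \<omega> where \<omega>: "\<omega> \<in> space (uniform_digits d)" "base_expansion b \<omega> \<in> {x - r<..<x + r}"
      by blast
    then have "\<And>k. \<omega> k < d" by (simp add: in_space_digit_measure_iff)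
    from base_expansion_bounds[where \<omega> = \<omega> and n = 0, OF assms(1) this] \<omega>(2) show ?thesis
      by (intro bexI[of _ "base_expansion b \<omega>"]) (simp_all add: digits_value_def)
  qed
  note near = this
  show "0 \<le> x"
  proof (rule ccontr)
    assume "\<not> 0 \<le> x"
    with near[of "- x"] show False by auto
  qed
  show "x \<le> (real d - 1) / (real b - 1)"
  proof (rule ccontr)
    assume "\<not> x \<le> (real d - 1) / (real b - 1)"
    with near[of "x - (real d - 1) / (real b - 1)"] show False by auto
  qed
qed

lemma support_bound_le:
  assumes "2 \<le> b" "b \<le> d"
  shows "(real d - 1) / (real b - 1) \<le> real d - 1"
proof -
  have "(real d - 1) * 1 \<le> (real d - 1) * (real b - 1)"
    using assms by (intro mult_left_mono) auto
  then show ?thesis using assms by (simp add: divide_le_eq)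
qed

text \<open>
If the first \<open>n\<close> digits of \<open>X\<close> represent \<open>m\<close>, then \<open>b^n X\<close> is within \<open>d + (d - 1) / (b - 1) < 2 d\<close> of \<open>b^n x\<close>; the radius
\<open>2 d / b^n\<close> is chosen for this. Each of the representations accounts for probability \<open>d^-n\<close>.
\<close>

lemma card_short_representations_le_measure:
  assumes "2 \<le> b" "b \<le> d" "\<bar>real m - real b ^ n * x\<bar> \<le> real d" "r = 2 * real d / real b ^ n"
  shows "real (card (short_representations b d n m))
    \<le> real d ^ n * measure (uniform_convolution b d) {x - r<..<x + r}"
proof -
  have "0 < d" using assms by simp
  interpret prob_space "uniform_digits d"
    by (rule prob_space_uniform_digits[OF \<open>0 < d\<close>])
  have sub: "short_representations b d n m \<subseteq> digit_strings d n"
    by (auto simp: short_representations_def)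
  have "{\<omega> \<in> space (uniform_digits d). reversed_prefix n \<omega> \<in> short_representations b d n m}
      \<subseteq> {\<omega> \<in> space (uniform_digits d). base_expansion b \<omega> \<in> {x - r<..<x + r}}"
  proof safe
    fix \<omega> assume \<omega>: "\<omega> \<in> space (uniform_digits d)" "reversed_prefix n \<omega> \<in> short_representations b d n m"
    let ?X = "base_expansion b \<omega>"
    have "\<And>k. \<omega> k < d" using \<omega>(1) by (simp add: in_space_digit_measure_iff)
    from base_expansion_bounds[where \<omega> = \<omega> and n = n, OF assms(1) this]
    have "real m \<le> real b ^ n * ?X" "real b ^ n * ?X \<le> real m + (real d - 1) / (real b - 1)"
      using \<omega>(2) by (simp_all add: short_representations_def)
    then have "\<bar>real b ^ n * ?X - real b ^ n * x\<bar> < 2 * real d"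
      using assms(3) support_bound_le[OF assms(1,2)] \<open>0 < d\<close> by linarith
    then have "real b ^ n * \<bar>?X - x\<bar> < 2 * real d"
      using assms(1) by (simp add: abs_mult flip: right_diff_distrib)
    then have "\<bar>?X - x\<bar> < r"
      using assms(1) by (simp add: assms(4) field_simps)
    then show "?X \<in> {x - r<..<x + r}" by auto
  qed
  then have "prob {\<omega> \<in> space (uniform_digits d). reversed_prefix n \<omega> \<in> short_representations b d n m}
      \<le> prob {\<omega> \<in> space (uniform_digits d). base_expansion b \<omega> \<in> {x - r<..<x + r}}"
    by (rule finite_measure_mono) (rule sets_base_expansion, simp)
  then have "real (card (short_representations b d n m)) / real d ^ n
      \<le> measure (uniform_convolution b d) {x - r<..<x + r}"
    by (simp add: prob_reversed_prefix[OF \<open>0 < d\<close> sub] measure_uniform_convolution)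
  then show ?thesis using \<open>0 < d\<close> by (simp add: field_simps)
qed

lemma integers_near_real:
  fixes y :: real
  shows "finite {m::nat. \<bar>real m - y\<bar> \<le> real c}" "card {m::nat. \<bar>real m - y\<bar> \<le> real c} \<le> 2 * c + 2"
proof -
  \<comment> \<open>If \<open>\<lfloor>y\<rfloor> < c\<close>, truncation gives \<open>?l = 0\<close>, which is still a lower bound for naturals.\<close>
  let ?l = "nat \<lfloor>y\<rfloor> - c"
  have sub: "{m::nat. \<bar>real m - y\<bar> \<le> real c} \<subseteq> {?l..<?l + (2 * c + 2)}"
  proof
    fix m assume "m \<in> {m::nat. \<bar>real m - y\<bar> \<le> real c}"
    then have "real m - real c \<le> y" "y \<le> real m + real c" by (auto simp: abs_le_iff)
    then have "int m - int c \<le> \<lfloor>y\<rfloor>" "\<lfloor>y\<rfloor> \<le> int m + int c"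
      by (simp_all add: le_floor_iff floor_le_iff)
    then show "m \<in> {?l..<?l + (2 * c + 2)}" by auto
  qed
  then show "finite {m::nat. \<bar>real m - y\<bar> \<le> real c}" by (rule finite_subset) simp
  show "card {m::nat. \<bar>real m - y\<bar> \<le> real c} \<le> 2 * c + 2"
    using card_mono[OF _ sub] by simp
qed

text \<open>
If \<open>X\<close> is within \<open>b^-n\<close> of \<open>x\<close>, its first \<open>n\<close> digits represent an integer within
\<open>1 + (d - 1) / (b - 1) \<le> d\<close> of \<open>b^n x\<close>. There are at most \<open>2 d + 2\<close> such integers, and one of them must
carry at least the average share.
\<close>

lemma ex_many_short_representations:
  assumes "2 \<le> b" "b \<le> d" "r = 1 / real b ^ n"
    and pos: "0 < measure (uniform_convolution b d) {x - r<..<x + r}"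
  shows "\<exists>m. \<bar>real m - real b ^ n * x\<bar> \<le> real d \<and>
    real d ^ n * measure (uniform_convolution b d) {x - r<..<x + r}
      \<le> (2 * real d + 2) * real (card (short_representations b d n m))"
proof (rule ccontr)
  assume contra: "\<not> ?thesis"
  have "0 < d" using assms by simp
  interpret prob_space "uniform_digits d"
    by (rule prob_space_uniform_digits[OF \<open>0 < d\<close>])
  define z where "z = real d ^ n * measure (uniform_convolution b d) {x - r<..<x + r}"
  define M where "M = {m::nat. \<bar>real m - real b ^ n * x\<bar> \<le> real d}"
  define W where "W = (\<Union>m\<in>M. short_representations b d n m)"
  have sub: "W \<subseteq> digit_strings d n" by (auto simp: W_def short_representations_def)
  have M: "finite M" "card M \<le> 2 * d + 2" unfolding M_def by (rule integers_near_real)+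
  have "0 < z" using pos \<open>0 < d\<close> by (simp add: z_def)
  have "{\<omega> \<in> space (uniform_digits d). base_expansion b \<omega> \<in> {x - r<..<x + r}}
      \<subseteq> {\<omega> \<in> space (uniform_digits d). reversed_prefix n \<omega> \<in> W}"
  proof safe
    fix \<omega> assume \<omega>: "\<omega> \<in> space (uniform_digits d)" "base_expansion b \<omega> \<in> {x - r<..<x + r}"
    let ?X = "base_expansion b \<omega>" and ?m = "digits_value b n (reversed_prefix n \<omega>)"
    have "\<And>k. \<omega> k < d" using \<omega>(1) by (simp add: in_space_digit_measure_iff)
    note bounds = base_expansion_bounds[where \<omega> = \<omega> and n = n, OF assms(1) this]
    have "\<bar>?X - x\<bar> < 1 / real b ^ n" using \<omega>(2) unfolding assms(3) by auto
    then have "real b ^ n * \<bar>?X - x\<bar> < 1"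
      using assms(1) by (simp add: field_simps)
    then have "\<bar>real b ^ n * ?X - real b ^ n * x\<bar> < 1"
      using assms(1) by (simp add: abs_mult flip: right_diff_distrib)
    then have "?m \<in> M"
      using bounds support_bound_le[OF assms(1,2)] unfolding M_def mem_Collect_eq by linarith
    then show "reversed_prefix n \<omega> \<in> W"
      using reversed_prefix_in_digit_strings[OF \<omega>(1)] by (auto simp: W_def short_representations_def)
  qed
  then have "prob {\<omega> \<in> space (uniform_digits d). base_expansion b \<omega> \<in> {x - r<..<x + r}}
      \<le> prob {\<omega> \<in> space (uniform_digits d). reversed_prefix n \<omega> \<in> W}"
    by (rule finite_measure_mono) (rule sets_reversed_prefix[OF \<open>0 < d\<close> sub])
  then have "measure (uniform_convolution b d) {x - r<..<x + r} \<le> real (card W) / real d ^ n"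
    by (simp add: prob_reversed_prefix[OF \<open>0 < d\<close> sub] measure_uniform_convolution)
  then have "z \<le> real (card W)" using \<open>0 < d\<close> by (simp add: z_def field_simps)
  then have "W \<noteq> {}" using \<open>0 < z\<close> by auto
  then have "M \<noteq> {}" by (auto simp: W_def)
  have "real (card W) \<le> (\<Sum>m\<in>M. real (card (short_representations b d n m)))"
    unfolding W_def using card_UN_le[OF M(1), of "short_representations b d n"]
    by (simp only: of_nat_le_iff flip: of_nat_sum)
  also have "\<dots> < (\<Sum>m\<in>M. z / (2 * real d + 2))"
  proof (rule sum_strict_mono[OF M(1) \<open>M \<noteq> {}\<close>])
    fix m assume "m \<in> M"
    then have "(2 * real d + 2) * real (card (short_representations b d n m)) < z"
      using contra unfolding M_def z_def mem_Collect_eq by (meson not_le)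
    then show "real (card (short_representations b d n m)) < z / (2 * real d + 2)"
      by (simp add: pos_less_divide_eq mult.commute)
  qed
  also have "\<dots> = real (card M) * (z / (2 * real d + 2))" by simp
  also have "\<dots> \<le> (2 * real d + 2) * (z / (2 * real d + 2))"
    using M(2) \<open>0 < z\<close> by (intro mult_right_mono) auto
  also have "\<dots> = z" by (simp add: add_nonneg_eq_0_iff)
  finally show False using \<open>z \<le> real (card W)\<close> by simp
qed

section \<open>Local dimension and growth of the number of representations\<close>

text \<open>
The constant \<open>c\<close> disappears in the limit: \<open>ln (c / b^n)\<close> is asymptotic to \<open>- n ln b\<close>.
\<close>

lemma local_dim_level_set_ln_ball:
  assumes "x \<in> local_dim_level_set \<mu> \<alpha>" "1 < b" "0 < c"
  shows "(\<lambda>n. ln (measure \<mu> {x - c / b ^ n<..<x + c / b ^ n}) / real n) \<longlonglongrightarrow> - (\<alpha> * ln b)"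
proof -
  define r where "r n = c / b ^ n" for n
  have r: "0 < r n" for n using assms by (simp add: r_def)
  have "(\<lambda>n. c * inverse b ^ n) \<longlonglongrightarrow> c * 0"
    using assms(2) by (intro tendsto_mult tendsto_const LIMSEQ_power_zero) (simp add: inverse_less_1_iff)
  then have "r \<longlonglongrightarrow> 0"
    by (simp add: r_def[abs_def] divide_inverse power_inverse)
  then have "filterlim r (at_right 0) sequentially"
    using r by (intro tendsto_imp_filterlim_at_right) auto
  with assms(1) have quot: "(\<lambda>n. ln (measure \<mu> {x - r n<..<x + r n}) / ln (r n)) \<longlonglongrightarrow> \<alpha>"
    unfolding local_dim_level_set_def by (auto intro: filterlim_compose)
  have ln_r: "ln (r n) = ln c - real n * ln b" for n
    using assms by (simp add: r_def ln_div ln_realpow)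
  have "(\<lambda>n. ln c / real n - ln b) \<longlonglongrightarrow> 0 - ln b"
    by (intro tendsto_diff tendsto_const lim_const_over_n)
  moreover have "\<forall>\<^sub>F n in sequentially. ln c / real n - ln b = ln (r n) / real n"
    using eventually_gt_at_top[of 0] by eventually_elim (simp add: ln_r diff_divide_distrib)
  ultimately have scale: "(\<lambda>n. ln (r n) / real n) \<longlonglongrightarrow> - ln b"
    by (simp add: Lim_transform_eventually)
  have "\<forall>\<^sub>F n in sequentially. r n < 1"
    using order_tendstoD(2)[OF \<open>r \<longlonglongrightarrow> 0\<close>, of 1] by simp
  then have "\<forall>\<^sub>F n in sequentially.
      ln (measure \<mu> {x - r n<..<x + r n}) / ln (r n) * (ln (r n) / real n)
        = ln (measure \<mu> {x - r n<..<x + r n}) / real n"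
  proof eventually_elim
    case (elim n)
    then have "ln (r n) < 0" using r[of n] by simp
    then show ?case by simp
  qed
  with tendsto_mult[OF quot scale] show ?thesis
    unfolding r_def[symmetric] by (simp add: Lim_transform_eventually)
qed

text \<open>
The hypotheses on \<open>m\<close> are those provided by \<open>ex_many_short_representations\<close>. The number of representations of \<open>m n\<close>
lies between \<open>d^n\<close> times the measures of two intervals whose radii are constant multiples of \<open>b^-n\<close>,
up to constant factors, and both measures decay like \<open>b^(-n \<alpha>)\<close> on the logarithmic scale. The
strict inequality \<open>x < (d - 1) / (b - 1)\<close> enters the upper bound: it makes a number \<open>q\<close> of top digits
independent of \<open>n\<close> sufficient to absorb the digits beyond the \<open>n\<close>-th. Positivity of \<open>x\<close> gives \<open>m n\<close> the
exact order \<open>b^n\<close>.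
\<close>

lemma representation_growth:
  assumes "2 \<le> b" "b \<le> d"
    and x: "x \<in> local_dim_level_set (uniform_convolution b d) \<alpha>"
    and interior: "0 < x" "x < (real d - 1) / (real b - 1)"
    and near: "\<And>n. \<bar>real (m n) - real b ^ n * x\<bar> \<le> real d"
    and large: "\<And>n. real d ^ n * measure (uniform_convolution b d) {x - 1 / real b ^ n<..<x + 1 / real b ^ n}
      \<le> (2 * real d + 2) * real (card (short_representations b d n (m n)))"
  shows "(\<lambda>n. ln (real (num_representations b d (m n))) / ln (real (m n)))
    \<longlonglongrightarrow> ln (real d) / ln (real b) - \<alpha>"
    and "filterlim m at_top sequentially"
    and "\<exists>k. \<forall>n. m n < b ^ (n + k)"
proof -
  let ?L = "(real d - 1) / (real b - 1)"
  let ?\<mu> = "\<lambda>c n. measure (uniform_convolution b d) {x - c / real b ^ n<..<x + c / real b ^ n}"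
  let ?N = "\<lambda>n. real (num_representations b d (m n))"
  have b1: "1 < real b" "0 < d" using assms(1,2) by auto
  have bn: "1 \<le> real b ^ n" for n using b1 by simp
  have pos: "0 < ?\<mu> c n" if "0 < c" for c n
    using x that b1(1) by (simp add: local_dim_level_set_def)
  have quot: "(\<lambda>n. real (m n) / real b ^ n) \<longlonglongrightarrow> x"
  proof (rule LIM_zero_cancel, rule Lim_null_comparison)
    show "\<forall>\<^sub>F n in sequentially. norm (real (m n) / real b ^ n - x) \<le> real d * (1 / real b) ^ n"
    proof (rule always_eventually, rule allI)
      fix n
      have "real (m n) / real b ^ n - x = (real (m n) - real b ^ n * x) / real b ^ n"
        using b1 by (simp add: diff_divide_distrib)
      then have "norm (real (m n) / real b ^ n - x) = \<bar>real (m n) - real b ^ n * x\<bar> / real b ^ n"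
        by simp
      also have "\<dots> \<le> real d / real b ^ n"
        using near by (rule divide_right_mono) simp
      finally show "norm (real (m n) / real b ^ n - x) \<le> real d * (1 / real b) ^ n"
        by (simp add: power_one_over)
    qed
    have "(\<lambda>n. real d * (1 / real b) ^ n) \<longlonglongrightarrow> real d * 0"
      using b1 by (intro tendsto_mult tendsto_const LIMSEQ_power_zero) simp
    then show "(\<lambda>n. real d * (1 / real b) ^ n) \<longlonglongrightarrow> 0" by simp
  qed
  have "filterlim (\<lambda>n. real b ^ n) at_top sequentially"
    using filterlim_at_infinity_imp_norm_at_top[OF filterlim_realpow_sequentially_gt1[of "real b"]] b1(1)
    by (simp add: norm_power)
  with quot interior(1) have "filterlim (\<lambda>n. real (m n) / real b ^ n * real b ^ n) at_top sequentially"
    by (intro filterlim_tendsto_pos_mult_at_top)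
  then have "filterlim (\<lambda>n. real (m n)) at_top sequentially"
    using b1 by simp
  then show top: "filterlim m at_top sequentially"
    by (simp add: filterlim_sequentially_iff_filterlim_real)
  have m_pos: "\<forall>\<^sub>F n in sequentially. 2 \<le> m n"
    using top by (simp add: filterlim_at_top)
  have ln_m: "(\<lambda>n. ln (real (m n)) / real n) \<longlonglongrightarrow> ln (real b)"
  proof -
    have "(\<lambda>n. ln (real (m n) / real b ^ n) / real n) \<longlonglongrightarrow> 0"
      using tendsto_ln[OF quot] interior(1)
      by (intro real_tendsto_divide_at_top[OF _ filterlim_real_sequentially]) auto
    then have "(\<lambda>n. ln (real (m n) / real b ^ n) / real n + ln (real b)) \<longlonglongrightarrow> 0 + ln (real b)"
      by (intro tendsto_add tendsto_const)
    moreover have "\<forall>\<^sub>F n in sequentially.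
        ln (real (m n) / real b ^ n) / real n + ln (real b) = ln (real (m n)) / real n"
      using m_pos eventually_gt_at_top[of 0]
      by eventually_elim (use b1 in \<open>simp add: ln_div ln_realpow diff_divide_distrib\<close>)
    ultimately show ?thesis by (simp add: Lim_transform_eventually)
  qed
  obtain k where k: "x + real d < real b ^ k"
    using real_arch_pow[OF b1(1)] by blast
  have m_less: "m n < b ^ (n + k)" for n
  proof -
    have "real (m n) \<le> real b ^ n * x + real d" using near[of n] by linarith
    also have "\<dots> \<le> real b ^ n * x + real b ^ n * real d"
      using bn[of n] by (simp add: mult_le_cancel_right1)
    also have "\<dots> = real b ^ n * (x + real d)" by (simp add: distrib_left)
    also have "\<dots> < real b ^ n * real b ^ k"
      using k b1 by (intro mult_strict_left_mono) auto
    finally have "real (m n) < real (b ^ (n + k))" by (simp add: power_add)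
    then show ?thesis by (simp only: of_nat_less_iff)
  qed
  then show "\<exists>k. \<forall>n. m n < b ^ (n + k)" by blast
  \<comment> \<open>With this \<open>q\<close> the bound \<open>b^q x + d\<close> on \<open>m n / b^p\<close>, where \<open>n = p + q\<close>, stays below
    the largest value \<open>(b^q - 1) L\<close> of \<open>q\<close> digits, where \<open>L = (d - 1) / (b - 1)\<close>.\<close>
  obtain q where q: "(real d + ?L) / (?L - x) < real b ^ q"
    using real_arch_pow[OF b1(1)] by blast
  have m_le: "m (p + q) * (b - 1) \<le> b ^ p * ((b ^ q - 1) * (d - 1))" for p
  proof -
    have "real d + ?L < real b ^ q * (?L - x)"
      using q interior(2) by (simp add: pos_divide_less_eq)
    then have "real b ^ q * x + real d \<le> (real b ^ q - 1) * ?L"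
      unfolding right_diff_distrib left_diff_distrib mult_1_left by linarith
    then have "real b ^ p * (real b ^ q * x + real d) \<le> real b ^ p * ((real b ^ q - 1) * ?L)"
      by (rule mult_left_mono) simp
    moreover have "real d \<le> real b ^ p * real d"
      using bn[of p] by (simp add: mult_le_cancel_right1)
    moreover have "real (m (p + q)) \<le> real b ^ (p + q) * x + real d" using near[of "p + q"] by linarith
    ultimately have "real (m (p + q)) \<le> real b ^ p * ((real b ^ q - 1) * ?L)"
      by (simp add: power_add distrib_left mult.assoc)
    then have "real (m (p + q)) * (real b - 1) \<le> real b ^ p * ((real b ^ q - 1) * ?L) * (real b - 1)"
      using b1 by (intro mult_right_mono) auto
    also have "\<dots> = real b ^ p * ((real b ^ q - 1) * (real d - 1))"
      using b1 by simp
    finally have "real (m (p + q) * (b - 1)) \<le> real (b ^ p * ((b ^ q - 1) * (d - 1)))"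
      using assms(1,2) by (simp add: of_nat_diff Suc_le_eq)
    then show ?thesis by (simp only: of_nat_le_iff)
  qed
  have lower: "real d ^ n * ?\<mu> 1 n / (2 * real d + 2) \<le> ?N n" for n
  proof -
    have "card (short_representations b d n (m n)) \<le> num_representations b d (m n)"
      unfolding num_representations_def
      using finite_representations[OF assms(1)] short_representations_subset by (rule card_mono)
    then have "(2 * real d + 2) * real (card (short_representations b d n (m n)))
        \<le> (2 * real d + 2) * ?N n" by (intro mult_left_mono) auto
    with large[of n] have "real d ^ n * ?\<mu> 1 n \<le> (2 * real d + 2) * ?N n"
      by (rule order_trans)
    then show ?thesis by (simp add: divide_le_eq mult.commute)
  qed
  have upper: "?N n \<le> real d ^ (k + q) * (real d ^ n * ?\<mu> (2 * real d) n)" if "q \<le> n" for n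
  proof -
    define p where "p = n - q"
    have n: "n = p + q" using that by (simp add: p_def)
    have "num_representations b d (m n) \<le> d ^ (k + q) * card (short_representations b d n (m n))"
      using num_representations_le[OF assms(1,2), of "m n" p q k] m_less[of n] m_le[of p]
      by (simp add: n)
    then have "?N n \<le> real (d ^ (k + q) * card (short_representations b d n (m n)))"
      by (simp only: of_nat_le_iff)
    also have "\<dots> = real d ^ (k + q) * real (card (short_representations b d n (m n)))" by simp
    also have "\<dots> \<le> real d ^ (k + q) * (real d ^ n * ?\<mu> (2 * real d) n)"
      using card_short_representations_le_measure[OF assms(1,2) near refl, of n]
      by (intro mult_left_mono) auto
    finally show ?thesis .
  qed
  have lim_lower: "(\<lambda>n. ln (real d ^ n * ?\<mu> 1 n / (2 * real d + 2)) / real n)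
      \<longlonglongrightarrow> ln (real d) - \<alpha> * ln (real b)"
  proof -
    have "(\<lambda>n. ln (real d) + ln (?\<mu> 1 n) / real n - ln (2 * real d + 2) / real n)
        \<longlonglongrightarrow> ln (real d) + - (\<alpha> * ln (real b)) - 0"
      by (intro tendsto_add tendsto_diff tendsto_const lim_const_over_n
          local_dim_level_set_ln_ball[OF x b1(1)]) simp
    moreover have "\<forall>\<^sub>F n in sequentially. ln (real d) + ln (?\<mu> 1 n) / real n - ln (2 * real d + 2) / real n
        = ln (real d ^ n * ?\<mu> 1 n / (2 * real d + 2)) / real n"
      using eventually_gt_at_top[of 0]
    proof eventually_elim
      case (elim n)
      have "ln (real d ^ n * ?\<mu> 1 n / (2 * real d + 2))
          = real n * ln (real d) + ln (?\<mu> 1 n) - ln (2 * real d + 2)"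
        using pos[of 1 n] b1(2) by (subst ln_div) (auto simp: ln_mult ln_realpow)
      then show ?case using elim by (simp add: add_divide_distrib diff_divide_distrib)
    qed
    ultimately show ?thesis by (simp add: Lim_transform_eventually)
  qed
  have lim_upper: "(\<lambda>n. ln (real d ^ (k + q) * (real d ^ n * ?\<mu> (2 * real d) n)) / real n)
      \<longlonglongrightarrow> ln (real d) - \<alpha> * ln (real b)"
  proof -
    have "(\<lambda>n. ln (real d ^ (k + q)) / real n + (ln (real d) + ln (?\<mu> (2 * real d) n) / real n))
        \<longlonglongrightarrow> 0 + (ln (real d) + - (\<alpha> * ln (real b)))"
      using b1(2) by (intro tendsto_add tendsto_const lim_const_over_n
          local_dim_level_set_ln_ball[OF x b1(1)]) simp
    moreover have "\<forall>\<^sub>F n in sequentially.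
        ln (real d ^ (k + q)) / real n + (ln (real d) + ln (?\<mu> (2 * real d) n) / real n)
        = ln (real d ^ (k + q) * (real d ^ n * ?\<mu> (2 * real d) n)) / real n"
      using eventually_gt_at_top[of 0]
    proof eventually_elim
      case (elim n)
      have "ln (real d ^ n * ?\<mu> (2 * real d) n) = real n * ln (real d) + ln (?\<mu> (2 * real d) n)"
        using pos[of "2 * real d" n] b1(2) by (subst ln_mult) (auto simp: ln_realpow)
      moreover have "ln (real d ^ (k + q) * (real d ^ n * ?\<mu> (2 * real d) n))
          = ln (real d ^ (k + q)) + ln (real d ^ n * ?\<mu> (2 * real d) n)"
        using pos[of "2 * real d" n] b1(2) by (subst ln_mult) auto
      ultimately show ?case using elim by (simp add: add_divide_distrib)
    qed
    ultimately show ?thesis by (simp add: Lim_transform_eventually)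
  qed
  have lower_pos: "0 < real d ^ n * ?\<mu> 1 n / (2 * real d + 2)" for n
    using pos[of 1 n] b1(2) by simp
  have lim_N: "(\<lambda>n. ln (?N n) / real n) \<longlonglongrightarrow> ln (real d) - \<alpha> * ln (real b)"
  proof (rule tendsto_sandwich[OF _ _ lim_lower lim_upper])
    show "\<forall>\<^sub>F n in sequentially. ln (real d ^ n * ?\<mu> 1 n / (2 * real d + 2)) / real n \<le> ln (?N n) / real n"
    proof (rule always_eventually, rule allI)
      fix n
      have "ln (real d ^ n * ?\<mu> 1 n / (2 * real d + 2)) \<le> ln (?N n)"
        using lower lower_pos by (rule ln_mono)
      then show "ln (real d ^ n * ?\<mu> 1 n / (2 * real d + 2)) / real n \<le> ln (?N n) / real n"
        by (rule divide_right_mono) simp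
    qed
    show "\<forall>\<^sub>F n in sequentially. ln (?N n) / real n
        \<le> ln (real d ^ (k + q) * (real d ^ n * ?\<mu> (2 * real d) n)) / real n"
      using eventually_ge_at_top[of q]
    proof eventually_elim
      case (elim n)
      have "0 < ?N n" using lower_pos[of n] lower[of n] by linarith
      then have "ln (?N n) \<le> ln (real d ^ (k + q) * (real d ^ n * ?\<mu> (2 * real d) n))"
        by (rule ln_mono[OF upper[OF elim]])
      then show ?case by (rule divide_right_mono) simp
    qed
  qed
  have "(\<lambda>n. (ln (?N n) / real n) / (ln (real (m n)) / real n))
      \<longlonglongrightarrow> (ln (real d) - \<alpha> * ln (real b)) / ln (real b)"
    using b1(1) by (intro tendsto_divide[OF lim_N ln_m]) simp
  moreover have "\<forall>\<^sub>F n in sequentially. (ln (?N n) / real n) / (ln (real (m n)) / real n)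
      = ln (?N n) / ln (real (m n))"
    using eventually_gt_at_top[of 0] by eventually_elim simp
  moreover have "(ln (real d) - \<alpha> * ln (real b)) / ln (real b) = ln (real d) / ln (real b) - \<alpha>"
    using b1(1) by (simp add: diff_divide_distrib)
  ultimately show "(\<lambda>n. ln (?N n) / ln (real (m n))) \<longlonglongrightarrow> ln (real d) / ln (real b) - \<alpha>"
    by (simp add: Lim_transform_eventually)
qed

text \<open>
The endpoints of the support are split off because the growth estimate needs an interior point; two
points do not matter in positive dimension.
\<close>

lemma level_set_subset_scaled_neighbourhoods:
  fixes \<alpha> :: real
  assumes "2 \<le> b" "b \<le> d" "0 < \<epsilon>"
  defines "S \<equiv> approx_level_set (\<lambda>n. real (num_representations b d n)) (ln (real d) / ln (real b) - \<alpha>) \<epsilon>"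
  shows "local_dim_level_set (uniform_convolution b d) \<alpha>
    \<subseteq> {0} \<union> ({(real d - 1) / (real b - 1)} \<union> (\<Union>k n0. scaled_neighbourhood b (real d) S k n0))"
proof
  fix x assume x: "x \<in> local_dim_level_set (uniform_convolution b d) \<alpha>"
  then have pos: "0 < measure (uniform_convolution b d) {x - r<..<x + r}" if "r > 0" for r
    using that by (simp add: local_dim_level_set_def)
  show "x \<in> {0} \<union> ({(real d - 1) / (real b - 1)} \<union> (\<Union>k n0. scaled_neighbourhood b (real d) S k n0))"
  proof (cases "x = 0 \<or> x = (real d - 1) / (real b - 1)")
    case False
    then have interior: "0 < x" "x < (real d - 1) / (real b - 1)"
      using support_uniform_convolution[OF assms(1) pos] by auto
    have "\<exists>m. \<bar>real m - real b ^ n * x\<bar> \<le> real d \<and>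
        real d ^ n * measure (uniform_convolution b d) {x - 1 / real b ^ n<..<x + 1 / real b ^ n}
          \<le> (2 * real d + 2) * real (card (short_representations b d n m))" for n
      using assms(1) by (intro ex_many_short_representations[OF assms(1,2) refl] pos) simp
    then obtain m where m: "\<And>n. \<bar>real (m n) - real b ^ n * x\<bar> \<le> real d"
      "\<And>n. real d ^ n * measure (uniform_convolution b d) {x - 1 / real b ^ n<..<x + 1 / real b ^ n}
          \<le> (2 * real d + 2) * real (card (short_representations b d n (m n)))"
      by metis
    note growth = representation_growth[OF assms(1,2) x interior m]
    obtain k where k: "\<And>n. m n < b ^ (n + k)" using growth(3) by blast
    have "\<forall>\<^sub>F n in sequentially. m n \<in> S"
    proof -
      have "\<forall>\<^sub>F n in sequentially. 2 \<le> m n"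
        using growth(2) by (simp add: filterlim_at_top)
      then show ?thesis
        using tendstoD[OF growth(1) assms(3)]
        by eventually_elim (auto simp: S_def approx_level_set_def dist_real_def abs_if split: if_splits)
    qed
    then obtain n0 where n0: "\<And>n. n0 \<le> n \<Longrightarrow> m n \<in> S"
      by (auto simp: eventually_sequentially)
    have "x \<in> scaled_neighbourhood b (real d) S k n0"
      unfolding scaled_neighbourhood_def
    proof (intro CollectI allI impI bexI conjI)
      fix n assume "n0 \<le> n"
      then show "m n \<in> S" by (rule n0)
      then show "1 \<le> m n" by (simp add: S_def approx_level_set_def)
    qed (rule k m)+
    then show ?thesis by blast
  qed auto
qed

theorem theorem21:
  fixes b d :: nat and \<alpha> :: real
  assumes "2 \<le> b" and "b \<le> d"
  shows "hausdorff_dim (local_dim_level_set (bernoulli_convolution b d (\<lambda>_. 1 / real d)) \<alpha>)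
    \<le> level_set_lower_exp_density (\<lambda>n. real (num_representations b d n))
        (ln (real d) / ln (real b) - \<alpha>)"
    (is "hausdorff_dim ?E \<le> ?D")
proof (rule dense_ge)
  fix z assume "?D < z"
  then obtain s where s: "?D < ereal s" "ereal s < z" using ereal_dense2 by blast
  then obtain \<epsilon> where "0 < \<epsilon>" and density: "lower_exp_density (approx_level_set
      (\<lambda>n. real (num_representations b d n)) (ln (real d) / ln (real b) - \<alpha>) \<epsilon>) < ereal s"
      (is "lower_exp_density ?S < _")
    by (auto simp: level_set_lower_exp_density_def INF_less_iff)
  have "0 < s"
    using le_less_trans[OF lower_exp_density_nonneg density] by simp
  have "hausdorff_measure s (scaled_neighbourhood b (real d) ?S k n0) = 0" for k n0
    by (rule hausdorff_null_scaled_neighbourhood[OF assms(1) _ density]) simp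
  then have "hausdorff_measure s ({0} \<union> ({(real d - 1) / (real b - 1)} \<union>
      (\<Union>k n0. scaled_neighbourhood b (real d) ?S k n0))) = 0"
    using \<open>0 < s\<close> by (intro hausdorff_null_Un hausdorff_null_singleton hausdorff_null_UN)
  then have "hausdorff_measure s ?E = 0"
    by (rule hausdorff_null_subset)
      (rule level_set_subset_scaled_neighbourhoods[OF assms \<open>0 < \<epsilon>\<close>])
  then have "hausdorff_dim ?E \<le> ereal s"
    unfolding hausdorff_dim_def using \<open>0 < s\<close> by (intro INF_lower) auto
  then show "hausdorff_dim ?E \<le> z" using s(2) by simp
qed

end
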